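(* Let $M=(M_n)_{n\ge0}$ be any discrete time skip free process. Assume that for all $a\in\{0,1,2\}$, $$\Theta^a(M)\stackrel{\mathcal L}{=}M .$$ Then $M$ is a discrete Ocone local martingale with respect to its natural filtration. If in addition $T_1<\infty$ almost surely, then $M$ is a divergent local martingale.
   Context: A discrete time skip free process is any measurable stochastic process $M=(M_n)_{n\ge0}$ with $M_0=0$ and $\Delta M_n=M_n-M_{n-1}\in\{-1,0,1\}$ for all $n\ge1$. The symbol $\stackrel{\mathcal L}{=}$ denotes equality in law of processes. For an integer $a\ge0$, $T_a=T_a(M)=\inf\{k\ge0:M_k=a\}$, with $\inf\emptyset=+\infty$, and $$\Theta^a(M)_n=\sum_{k=1}^n\left(\mathbf 1_{\{k\le T_a\}}-\mathbf 1_{\{k>T_a\}}\right)\Delta M_k ,\qquad n\ge0.$$ The quadratic variation of $M$ is $[M]_0=0$, $[M]_n=\sum_{k=0}^{n-1}(M_{k+1}-M_k)^2$ for $n\ge1$. $M$ is called divergent if $\lim_{n\to\infty}[M]_n=+\infty$ almost surely. A discrete Ocone local martingale is a symmetric Bernoulli random walk time-changed by an independent increasing skip free process, i.e. (possibly after enlarging the probability space) $M_n=S_{A_n}$ for all $n\ge0$, where $S=(S_k)_{k\ge 0}$, $S_0=0$, is a random walk with i.i.d. increments uniform on $\{-1,+1\}$ and $A=(A_n)_{n\ge0}$ is a nondecreasing skip free process ($A_0=0$, $A_{n}-A_{n-1}\in\{0,1\}$) independent of $S$. Such a process is a local martingale with respect to its natural filtration. *)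

theory Defs
  imports "HOL-Probability.Probability"
begin

definition skip_free :: "'a measure \<Rightarrow> (nat \<Rightarrow> 'a \<Rightarrow> int) \<Rightarrow> bool" where
  "skip_free P M \<longleftrightarrow>
     (\<forall>n. M n \<in> measurable P (count_space UNIV)) \<and>
     (\<forall>\<omega>\<in>space P. M 0 \<omega> = 0 \<and> (\<forall>n\<ge>1. M n \<omega> - M (n - 1) \<omega> \<in> {-1, 0, 1}))"

abbreviation path_space :: "(nat \<Rightarrow> int) measure" where
  "path_space \<equiv> PiM UNIV (\<lambda>_. count_space UNIV)"

abbreviation (input) sample_path :: "(nat \<Rightarrow> 'a \<Rightarrow> int) \<Rightarrow> 'a \<Rightarrow> nat \<Rightarrow> int" where
  "sample_path X \<equiv> (\<lambda>\<omega> n. X n \<omega>)"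

definition equal_in_law ::
  "'a measure \<Rightarrow> (nat \<Rightarrow> 'a \<Rightarrow> int) \<Rightarrow> (nat \<Rightarrow> 'a \<Rightarrow> int) \<Rightarrow> bool" where
  "equal_in_law P X Y \<longleftrightarrow> distr P path_space (sample_path X) = distr P path_space (sample_path Y)"

definition hitting_time :: "int \<Rightarrow> (nat \<Rightarrow> int) \<Rightarrow> enat" where
  "hitting_time a x = Inf {enat k |k. x k = a}"

definition reflect :: "int \<Rightarrow> (nat \<Rightarrow> int) \<Rightarrow> nat \<Rightarrow> int" where
  "reflect a x n =
     (\<Sum>k=1..n. (of_bool (enat k \<le> hitting_time a x) - of_bool (enat k > hitting_time a x))
                  * (x k - x (k - 1)))"

definition quadratic_variation :: "(nat \<Rightarrow> int) \<Rightarrow> nat \<Rightarrow> int" where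
  "quadratic_variation x n = (\<Sum>k<n. (x (k + 1) - x k)\<^sup>2)"

definition divergent :: "'a measure \<Rightarrow> (nat \<Rightarrow> 'a \<Rightarrow> int) \<Rightarrow> bool" where
  "divergent P M \<longleftrightarrow>
     (AE \<omega> in P. filterlim (quadratic_variation (sample_path M \<omega>)) at_top sequentially)"

definition symmetric_bernoulli_walk :: "'a measure \<Rightarrow> (nat \<Rightarrow> 'a \<Rightarrow> int) \<Rightarrow> bool" where
  "symmetric_bernoulli_walk P S \<longleftrightarrow>
     (\<forall>\<omega>\<in>space P. S 0 \<omega> = 0) \<and>
     prob_space.indep_vars P (\<lambda>_. count_space UNIV) (\<lambda>k \<omega>. S (Suc k) \<omega> - S k \<omega>) UNIV \<and>
     (\<forall>k. distr P (count_space UNIV) (\<lambda>\<omega>. S (Suc k) \<omega> - S k \<omega>)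
            = measure_pmf (pmf_of_set {-1, 1}))"

definition increasing_skip_free :: "'a measure \<Rightarrow> (nat \<Rightarrow> 'a \<Rightarrow> int) \<Rightarrow> bool" where
  "increasing_skip_free P A \<longleftrightarrow> skip_free P A \<and> (\<forall>\<omega>\<in>space P. mono (sample_path A \<omega>))"

definition is_enlargement :: "'a measure \<Rightarrow> 'b measure \<Rightarrow> ('b \<Rightarrow> 'a) \<Rightarrow> bool" where
  "is_enlargement P Q \<phi> \<longleftrightarrow> prob_space Q \<and> \<phi> \<in> measurable Q P \<and> distr Q P \<phi> = P"

text \<open>
  HOL cannot quantify over the type of the enlarged sample space. Fixing it to
  \<open>'a \<times> (nat \<Rightarrow> int) \<times> (nat \<Rightarrow> int)\<close> loses nothing: given any enlargement \<open>\<phi>\<close> carrying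
  \<open>S\<close> and \<open>A\<close>, its image under \<open>(\<phi>, S, A)\<close> is an enlargement on this type with the same property.
\<close>

definition discrete_ocone :: "'a measure \<Rightarrow> (nat \<Rightarrow> 'a \<Rightarrow> int) \<Rightarrow> bool" where
  "discrete_ocone P M \<longleftrightarrow>
     (\<exists>(Q :: ('a \<times> (nat \<Rightarrow> int) \<times> (nat \<Rightarrow> int)) measure) \<phi> S A.
        is_enlargement P Q \<phi> \<and>
        symmetric_bernoulli_walk Q S \<and>
        increasing_skip_free Q A \<and>
        prob_space.indep_var Q path_space (sample_path S) path_space (sample_path A) \<and>
        (\<forall>n. \<forall>\<omega>\<in>space Q. M n (\<phi> \<omega>) = S (nat (A n \<omega>)) \<omega>))"

definition natural_filtration ::
  "'a measure \<Rightarrow> (nat \<Rightarrow> 'a \<Rightarrow> int) \<Rightarrow> nat \<Rightarrow> 'a measure" where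
  "natural_filtration P M n = sigma (space P) {M k -` B \<inter> space P |k B. k \<le> n}"

definition martingale ::
  "'a measure \<Rightarrow> (nat \<Rightarrow> 'a measure) \<Rightarrow> (nat \<Rightarrow> 'a \<Rightarrow> real) \<Rightarrow> bool" where
  "martingale P F X \<longleftrightarrow>
     filtration (space P) F \<and> (\<forall>n. subalgebra P (F n)) \<and>
     (\<forall>n. X n \<in> borel_measurable (F n) \<and> integrable P (X n)) \<and>
     (\<forall>m n. m \<le> n \<longrightarrow> (AE \<omega> in P. real_cond_exp P (F m) (X n) \<omega> = X m \<omega>))"

text \<open>
  The library's \<open>stopping_time\<close> takes values in the index set of the filtration; here the index
  set is \<open>nat\<close> and the value \<open>\<infinity>\<close> is allowed.
\<close>

definition extended_stopping_time :: "(nat \<Rightarrow> 'a measure) \<Rightarrow> ('a \<Rightarrow> enat) \<Rightarrow> bool" where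
  "extended_stopping_time F \<tau> \<longleftrightarrow> (\<forall>n. Measurable.pred (F n) (\<lambda>\<omega>. \<tau> \<omega> \<le> enat n))"

definition stopped :: "(nat \<Rightarrow> 'a \<Rightarrow> real) \<Rightarrow> ('a \<Rightarrow> enat) \<Rightarrow> nat \<Rightarrow> 'a \<Rightarrow> real" where
  "stopped X \<tau> n \<omega> = X (the_enat (min (enat n) (\<tau> \<omega>))) \<omega>"

definition local_martingale ::
  "'a measure \<Rightarrow> (nat \<Rightarrow> 'a measure) \<Rightarrow> (nat \<Rightarrow> 'a \<Rightarrow> real) \<Rightarrow> bool" where
  "local_martingale P F X \<longleftrightarrow>
     filtration (space P) F \<and> (\<forall>n. subalgebra P (F n)) \<and>
     (\<forall>n. X n \<in> borel_measurable (F n)) \<and>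
     (\<exists>\<tau> :: nat \<Rightarrow> 'a \<Rightarrow> enat.
        (\<forall>j. extended_stopping_time F (\<tau> j)) \<and>
        (AE \<omega> in P. mono (\<lambda>j. \<tau> j \<omega>) \<and> (SUP j. \<tau> j \<omega>) = \<infinity>) \<and>
        (\<forall>j. martingale P F (stopped X (\<tau> j))))"

abbreviation natural_local_martingale :: "'a measure \<Rightarrow> (nat \<Rightarrow> 'a \<Rightarrow> int) \<Rightarrow> bool" where
  "natural_local_martingale P M \<equiv>
     local_martingale P (natural_filtration P M) (\<lambda>n \<omega>. real_of_int (M n \<omega>))"

end

theory Submission
  imports Defs
begin

text \<open>
  The three reflections preserve the absolute increments, and they act transitively on the paths
  of length \<open>n\<close> with given absolute increments: by induction, two such paths can be moved onto a
  common pivot up to time \<open>n - 1\<close>, where the pivot hits \<open>0\<close>, \<open>1\<close> or \<open>2\<close> (according to the parity of its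
  number of jumps) for the first time with its last jump, so that the corresponding reflection flips
  just the \<open>n\<close>-th increment. Hence the probability of a finite path depends only on its absolute
  increments, and the law of \<open>M\<close> is invariant under every predictable change of signs. Flipping all
  increments after time \<open>m\<close> gives the martingale property. Flipping the \<open>i\<close>-th nonzero jump,
  where missing jumps are replaced by independent fair coins, shows that the nonzero jumps are
  fair coins independent of the quadratic variation, which serves as the clock.
\<close>

section \<open>Path prefixes, lattice paths and quadratic variation\<close>

definition agree_upto :: "nat \<Rightarrow> (nat \<Rightarrow> int) \<Rightarrow> (nat \<Rightarrow> int) \<Rightarrow> bool" where
  "agree_upto n x y \<longleftrightarrow> (\<forall>k\<le>n. x k = y k)"

lemma agree_upto_refl [simp]: "agree_upto n x x"
  by (simp add: agree_upto_def)

lemma agree_upto_sym: "agree_upto n x y \<Longrightarrow> agree_upto n y x"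
  by (simp add: agree_upto_def)

lemma agree_upto_mono: "agree_upto n x y \<Longrightarrow> m \<le> n \<Longrightarrow> agree_upto m x y"
  by (simp add: agree_upto_def)

lemma agree_upto_Suc: "agree_upto (Suc n) x y \<longleftrightarrow> agree_upto n x y \<and> x (Suc n) = y (Suc n)"
  by (auto simp: agree_upto_def le_Suc_eq)

definition lattice_path :: "(nat \<Rightarrow> int) \<Rightarrow> bool" where
  "lattice_path x \<longleftrightarrow> x 0 = 0 \<and> (\<forall>k. \<bar>x (Suc k) - x k\<bar> \<le> 1)"

lemma lattice_path_abs:
  assumes "lattice_path x"
  shows "\<bar>x n\<bar> \<le> int n"
proof (induction n)
  case 0
  then show ?case using assms by (simp add: lattice_path_def)
next
  case (Suc n)
  have "\<bar>x (Suc n) - x n\<bar> \<le> 1" using assms by (simp add: lattice_path_def)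
  with Suc show ?case by simp
qed

lemma quadratic_variation_0 [simp]: "quadratic_variation x 0 = 0"
  by (simp add: quadratic_variation_def)

lemma quadratic_variation_Suc:
  "quadratic_variation x (Suc n) = quadratic_variation x n + (x (Suc n) - x n)\<^sup>2"
  by (simp add: quadratic_variation_def)

lemma mono_quadratic_variation: "mono (quadratic_variation x)"
  by (rule mono_iff_le_Suc[THEN iffD2]) (simp add: quadratic_variation_Suc)

lemma quadratic_variation_nonneg: "0 \<le> quadratic_variation x n"
  by (simp add: quadratic_variation_def sum_nonneg)

lemma square_eq_abs_int: "\<bar>d\<bar> \<le> 1 \<Longrightarrow> d\<^sup>2 = \<bar>d\<bar>" for d :: int
proof -
  assume "\<bar>d\<bar> \<le> 1"
  then have "d = -1 \<or> d = 0 \<or> d = 1" by arith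
  then show ?thesis by auto
qed

text \<open>Steps in {-1, 0, 1} have equal square and absolute value. Hence the quadratic variation
  of a lattice path counts its nonzero jumps.\<close>

lemma quadratic_variation_Suc_lattice:
  "lattice_path x \<Longrightarrow> quadratic_variation x (Suc n) = quadratic_variation x n + \<bar>x (Suc n) - x n\<bar>"
  by (simp add: quadratic_variation_Suc lattice_path_def square_eq_abs_int)

subsection \<open>Predictable changes of sign\<close>

text \<open>\<open>\<sigma> k x\<close> is the sign given to the increment from time
  \<open>k\<close> to \<open>k + 1\<close>, so predictability means dependence on \<open>x\<close>
  up to time \<open>k\<close> only.\<close>

definition resign :: "(nat \<Rightarrow> (nat \<Rightarrow> int) \<Rightarrow> int) \<Rightarrow> (nat \<Rightarrow> int) \<Rightarrow> nat \<Rightarrow> int" where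
  "resign \<sigma> x n = (\<Sum>k<n. \<sigma> k x * (x (Suc k) - x k))"

text \<open>The last clause makes \<^term>\<open>resign \<sigma>\<close> an involution.\<close>

definition sign_rule :: "(nat \<Rightarrow> (nat \<Rightarrow> int) \<Rightarrow> int) \<Rightarrow> bool" where
  "sign_rule \<sigma> \<longleftrightarrow>
     (\<forall>k x. \<sigma> k x = 1 \<or> \<sigma> k x = -1) \<and>
     (\<forall>k x y. agree_upto k x y \<longrightarrow> \<sigma> k x = \<sigma> k y) \<and>
     (\<forall>k x. x 0 = 0 \<longrightarrow> \<sigma> k (resign \<sigma> x) = \<sigma> k x)"

lemma resign_0 [simp]: "resign \<sigma> x 0 = 0"
  by (simp add: resign_def)

lemma resign_increment: "resign \<sigma> x (Suc k) - resign \<sigma> x k = \<sigma> k x * (x (Suc k) - x k)"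
  by (simp add: resign_def)

lemma sign_rule_square: "sign_rule \<sigma> \<Longrightarrow> \<sigma> k x * \<sigma> k x = 1"
  unfolding sign_rule_def by (metis mult_1 mult_minus1 minus_minus)

lemma sign_rule_abs: "sign_rule \<sigma> \<Longrightarrow> \<bar>\<sigma> k x\<bar> = 1"
  unfolding sign_rule_def by (metis abs_1 abs_minus_cancel)

lemma abs_resign_increment:
  "sign_rule \<sigma> \<Longrightarrow> \<bar>resign \<sigma> x (Suc k) - resign \<sigma> x k\<bar> = \<bar>x (Suc k) - x k\<bar>"
  by (simp add: resign_increment abs_mult sign_rule_abs)

lemma lattice_path_resign:
  "sign_rule \<sigma> \<Longrightarrow> lattice_path x \<Longrightarrow> lattice_path (resign \<sigma> x)"
  by (simp add: lattice_path_def abs_resign_increment)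

lemma agree_upto_resign:
  assumes "sign_rule \<sigma>" "agree_upto n x y"
  shows "agree_upto n (resign \<sigma> x) (resign \<sigma> y)"
  unfolding agree_upto_def resign_def
proof (intro allI impI sum.cong refl)
  fix j k assume "j \<le> n" "k \<in> {..<j}"
  then have "agree_upto k x y" "x (Suc k) = y (Suc k)" "x k = y k"
    using assms(2) by (auto simp: agree_upto_def)
  then show "\<sigma> k x * (x (Suc k) - x k) = \<sigma> k y * (y (Suc k) - y k)"
    using assms(1) unfolding sign_rule_def by metis
qed

lemma resign_resign:
  assumes "sign_rule \<sigma>" "x 0 = 0"
  shows "resign \<sigma> (resign \<sigma> x) = x"
proof
  fix n
  have "\<sigma> k (resign \<sigma> x) = \<sigma> k x" for k
    using assms by (simp add: sign_rule_def)
  then have "resign \<sigma> (resign \<sigma> x) n = (\<Sum>k<n. (\<sigma> k x * \<sigma> k x) * (x (Suc k) - x k))"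
    unfolding resign_def[of \<sigma> "resign \<sigma> x"] by (simp add: resign_increment mult.assoc)
  also have "\<dots> = x n"
    using assms by (simp add: sign_rule_square sum_lessThan_telescope)
  finally show "resign \<sigma> (resign \<sigma> x) n = x n" .
qed

text \<open>By the involution, the preimage of a cylinder under \<open>resign \<sigma>\<close> is
  again a cylinder among paths started at 0.\<close>

lemma agree_upto_resign_iff:
  assumes "sign_rule \<sigma>" "x 0 = 0" "y 0 = 0"
  shows "agree_upto n (resign \<sigma> x) y \<longleftrightarrow> agree_upto n x (resign \<sigma> y)"
  by (metis agree_upto_resign assms resign_resign)

text \<open>Only unit signs are assumed, because the proof that \<open>jump_flip\<close> is a sign
  rule builds on this lemma.\<close>

lemma quadratic_variation_resign:
  assumes "\<And>k x. \<bar>\<sigma> k x\<bar> = 1"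
  shows "quadratic_variation (resign \<sigma> x) = quadratic_variation x"
proof
  fix n show "quadratic_variation (resign \<sigma> x) n = quadratic_variation x n"
    by (induction n)
      (simp_all add: quadratic_variation_Suc resign_increment power_mult_distrib
        power2_abs[of "\<sigma> _ _", symmetric] assms)
qed

lemma resign_eq_of_signs_one:
  "x 0 = 0 \<Longrightarrow> (\<And>i. i < j \<Longrightarrow> \<sigma> i x = 1) \<Longrightarrow> resign \<sigma> x j = x j"
  by (simp add: resign_def sum_lessThan_telescope)

section \<open>Reflections as predictable changes of sign\<close>

definition reflect_sign :: "int \<Rightarrow> nat \<Rightarrow> (nat \<Rightarrow> int) \<Rightarrow> int" where
  "reflect_sign a k x = (if \<exists>j\<le>k. x j = a then -1 else 1)"

lemma hitting_time_less_iff: "hitting_time a x < enat k \<longleftrightarrow> (\<exists>j<k. x j = a)"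
  by (auto simp: hitting_time_def Inf_less_iff)

lemma reflect_eq_resign: "reflect a = resign (reflect_sign a)"
proof (intro ext)
  fix x n
  have "reflect a x n = (\<Sum>k=1..n. reflect_sign a (k - 1) x * (x k - x (k - 1)))"
    unfolding reflect_def
  proof (intro sum.cong refl)
    fix k assume k: "k \<in> {1..n}"
    \<comment> \<open>Increment number \<open>k\<close> starts at time \<open>k - 1\<close>, so it
      is flipped exactly when \<open>a\<close> has been visited by time
      \<open>k - 1\<close>.\<close>
    have "(\<exists>j\<le>k - 1. x j = a) \<longleftrightarrow> hitting_time a x < enat k"
      unfolding hitting_time_less_iff using k
      by (metis One_nat_def Suc_pred atLeastAtMost_iff less_Suc_eq_le less_le_trans zero_less_one)
    then show "(of_bool (enat k \<le> hitting_time a x) - of_bool (enat k > hitting_time a x)) * (x k - x (k - 1))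
       = reflect_sign a (k - 1) x * (x k - x (k - 1))"
      by (auto simp: reflect_sign_def not_le)
  qed
  also have "\<dots> = resign (reflect_sign a) x n"
    unfolding resign_def
    by (rule sum.reindex_bij_witness[of _ Suc "\<lambda>k. k - 1"]) auto
  finally show "reflect a x n = resign (reflect_sign a) x n" .
qed

text \<open>All signs before the first visit to \<open>a\<close> are 1, so a path and its reflection
  coincide up to and including that visit. Both have therefore visited \<open>a\<close> by time
  \<open>k\<close> or neither has.\<close>

lemma sign_rule_reflect_sign: "sign_rule (reflect_sign a)"
proof -
  have "reflect_sign a k (resign (reflect_sign a) x) = reflect_sign a k x" if x: "x 0 = 0" for k x
  proof (cases "\<exists>j\<le>k. x j = a")
    case True
    define t where "t = (LEAST j. x j = a)"
    have t: "x t = a" "t \<le> k" "\<And>i. i < t \<Longrightarrow> x i \<noteq> a"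
      using True unfolding t_def by (auto intro: LeastI Least_le le_trans dest: not_less_Least)
    have "resign (reflect_sign a) x t = x t"
      by (rule resign_eq_of_signs_one[where x = x, OF x]) (use t(3) in \<open>auto simp: reflect_sign_def\<close>)
    then show ?thesis using t True unfolding reflect_sign_def[of a k] by auto
  next
    case False
    have "resign (reflect_sign a) x j = x j" if "j \<le> k" for j
      by (rule resign_eq_of_signs_one[where x = x, OF x]) (use False that in \<open>auto simp: reflect_sign_def\<close>)
    then show ?thesis using False unfolding reflect_sign_def[of a k] by auto
  qed
  moreover have "reflect_sign a k x = reflect_sign a k y" if "agree_upto k x y" for k x y
    using that by (auto simp: reflect_sign_def agree_upto_def)
  moreover have "reflect_sign a k x = 1 \<or> reflect_sign a k x = -1" for k x
    by (simp add: reflect_sign_def)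
  ultimately show ?thesis unfolding sign_rule_def by blast
qed

subsection \<open>Transitivity of the three reflections\<close>

abbreviation reflections :: "int list \<Rightarrow> (nat \<Rightarrow> int) \<Rightarrow> nat \<Rightarrow> int" where
  "reflections \<equiv> foldr reflect"

lemma lattice_path_reflections: "lattice_path x \<Longrightarrow> lattice_path (reflections as x)"
  by (induction as) (simp_all add: reflect_eq_resign lattice_path_resign sign_rule_reflect_sign)

lemma abs_reflections_increment:
  "\<bar>reflections as x (Suc k) - reflections as x k\<bar> = \<bar>x (Suc k) - x k\<bar>"
  by (induction as) (simp_all add: reflect_eq_resign abs_resign_increment sign_rule_reflect_sign)

lemma agree_upto_reflections:
  "agree_upto n x y \<Longrightarrow> agree_upto n (reflections as x) (reflections as y)"
  by (induction as) (simp_all add: reflect_eq_resign agree_upto_resign sign_rule_reflect_sign)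

lemma reflections_rev:
  assumes "lattice_path x"
  shows "reflections (rev as) (reflections as x) = x"
proof (induction as)
  case (Cons a as)
  have "reflections as x 0 = 0"
    using lattice_path_reflections[OF assms] by (simp add: lattice_path_def)
  then have "reflect a (reflect a (reflections as x)) = reflections as x"
    by (simp add: reflect_eq_resign[of a] resign_resign sign_rule_reflect_sign)
  then show ?case using Cons by simp
qed simp

text \<open>
  With \<open>m\<close> nonzero jumps before time \<open>n\<close>, the path oscillates between \<open>0\<close> and \<open>1\<close> (\<open>m\<close> even)
  or \<open>0\<close> and \<open>-1\<close> (\<open>m\<close> odd) and reaches \<open>a\<close> with its \<open>m\<close>-th jump for the first time, so that
  the reflection at \<open>a\<close> changes nothing but the next jump.
\<close>

lemma exists_pivot:
  assumes x: "lattice_path x"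
  obtains p a where "lattice_path p" "\<And>k. k < n \<Longrightarrow> \<bar>p (Suc k) - p k\<bar> = \<bar>x (Suc k) - x k\<bar>"
    "a \<in> {0, 1, 2}" "p n = a" "\<And>j k. j \<le> k \<Longrightarrow> k < n \<Longrightarrow> p j = a \<Longrightarrow> p (Suc k) = p k"
proof -
  define D where "D = quadratic_variation x"
  define m where "m = D n"
  \<comment> \<open>The last of the \<open>m\<close> jumps starts from \<open>g (m - 1)\<close>,
    which is 1 for even positive \<open>m\<close> and 0 for odd \<open>m\<close>; one more step up
    gives 2 or 1. Without jumps the path is already at its target 0.\<close>
  define a :: int where "a = (if m = 0 then 0 else if even m then 2 else 1)"
  define g :: "int \<Rightarrow> int" where
    "g j = (if j = m then a else if even m then j mod 2 else - (j mod 2))" for j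
  \<comment> \<open>Position as a function of the number of jumps made so far;
    \<open>min k n\<close> freezes the path after time \<open>n\<close>.\<close>
  define p where "p k = g (D (min k n))" for k
  have D0: "D 0 = 0" and Dnn: "0 \<le> D k" for k
    by (simp_all add: D_def quadratic_variation_nonneg)
  have DS: "D (Suc k) = D k + \<bar>x (Suc k) - x k\<bar>" and D1: "\<bar>x (Suc k) - x k\<bar> \<le> 1" for k
    using x by (simp_all add: D_def quadratic_variation_Suc_lattice) (simp add: lattice_path_def)
  have Dmono: "j \<le> k \<Longrightarrow> D j \<le> D k" for j k
    unfolding D_def by (rule monoD[OF mono_quadratic_variation])
  have m0: "0 \<le> m" by (simp add: m_def Dnn)
  have g0: "g 0 = 0" by (simp add: g_def a_def)
  have gstep: "\<bar>g (j + 1) - g j\<bar> = 1" if "0 \<le> j" "j < m" for j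
  proof -
    have *: "j mod 2 = (if even j then 0 else 1)" "(j + 1) mod 2 = (if even j then 1 else 0)" for j :: int
      by presburger+
    show ?thesis
      using that by (auto simp: g_def a_def *)
  qed
  have ga: "g j \<noteq> a" if "0 \<le> j" "j < m" for j
  proof -
    have "0 \<le> j mod 2" "j mod 2 \<le> 1" by presburger+
    then show ?thesis using that by (auto simp: g_def a_def)
  qed
  have inc: "\<bar>p (Suc k) - p k\<bar> = \<bar>x (Suc k) - x k\<bar>" if k: "k < n" for k
  proof (cases "x (Suc k) = x k")
    case True
    then have "D (Suc k) = D k" using DS[of k] by simp
    then show ?thesis using True k by (simp add: p_def min_def)
  next
    case False
    then have 1: "\<bar>x (Suc k) - x k\<bar> = 1" using D1[of k] by arith
    then have "D (Suc k) = D k + 1" using DS[of k] by simp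
    moreover from this have "D k < m" using Dmono[of "Suc k" n] k by (simp add: m_def)
    ultimately show ?thesis using gstep[of "D k"] Dnn[of k] k 1 by (simp add: p_def min_def)
  qed
  show ?thesis
  proof (rule that[of p a])
    show "lattice_path p"
      unfolding lattice_path_def
    proof (intro conjI allI)
      show "p 0 = 0" by (simp add: p_def D0 g0)
      fix k show "\<bar>p (Suc k) - p k\<bar> \<le> 1"
        using inc[of k] D1[of k] by (cases "k < n") (simp_all add: p_def min_def)
    qed
    show "\<bar>p (Suc k) - p k\<bar> = \<bar>x (Suc k) - x k\<bar>" if "k < n" for k using inc that .
    show "a \<in> {0, 1, 2}" by (simp add: a_def)
    show "p n = a" by (simp add: p_def g_def m_def)
    fix j k assume jk: "j \<le> k" "k < n" "p j = a"
    \<comment> \<open>By \<open>ga\<close> the value \<open>a\<close> is reached only once all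
      \<open>m\<close> jumps are made, so from time \<open>j\<close> to time \<open>n\<close> the
      counter \<open>D\<close> stays at \<open>m\<close>.\<close>
    then have "\<not> D j < m" using ga[of "D j"] Dnn[of j] by (auto simp: p_def min_def)
    then have "D (Suc k) = D k"
      using Dmono[of j k] Dmono[of k "Suc k"] Dmono[of "Suc k" n] jk by (simp add: m_def)
    then show "p (Suc k) = p k" using jk by (simp add: p_def min_def)
  qed
qed

text \<open>The pivot depends on the absolute increments alone, so it serves both paths. Once both
  are moved onto it, they differ at most in the sign of the last increment; one more reflection
  repairs this, and the reflections applied to \<open>y\<close> are undone in reverse order.\<close>

lemma reflections_transitive:
  assumes "lattice_path x" "lattice_path y"
    and "\<And>k. k < n \<Longrightarrow> \<bar>x (Suc k) - x k\<bar> = \<bar>y (Suc k) - y k\<bar>"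
  shows "\<exists>as. set as \<subseteq> {0, 1, 2} \<and> agree_upto n (reflections as x) y"
  using assms
proof (induction n arbitrary: x y)
  case 0
  then show ?case by (intro exI[of _ "[]"]) (simp add: agree_upto_def lattice_path_def)
next
  case (Suc n)
  obtain p a where p: "lattice_path p" "\<And>k. k < n \<Longrightarrow> \<bar>p (Suc k) - p k\<bar> = \<bar>x (Suc k) - x k\<bar>"
    "a \<in> {0, 1, 2}" "p n = a" "\<And>j k. j \<le> k \<Longrightarrow> k < n \<Longrightarrow> p j = a \<Longrightarrow> p (Suc k) = p k"
    using exists_pivot[OF Suc.prems(1), of n] by blast
  obtain as where as: "set as \<subseteq> {0, 1, 2}" "agree_upto n (reflections as x) p"
    using Suc.IH[of x p] Suc.prems p by auto
  obtain bs where bs: "set bs \<subseteq> {0, 1, 2}" "agree_upto n (reflections bs y) p"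
    using Suc.IH[of y p] Suc.prems p by auto
  define z where "z = reflections as x"
  define w where "w = reflections bs y"
  have z: "agree_upto n z p" and w: "agree_upto n w p"
    using as bs by (simp_all add: z_def w_def)
  have zw_abs: "\<bar>z (Suc n) - z n\<bar> = \<bar>w (Suc n) - w n\<bar>"
    using Suc.prems(3)[of n] by (simp add: z_def w_def abs_reflections_increment)
  have zw: "z n = w n" using z w by (simp add: agree_upto_def)
  have lz: "lattice_path z" by (simp add: z_def lattice_path_reflections Suc.prems)
  have "\<exists>cs. set cs \<subseteq> {0, 1, 2} \<and> agree_upto (Suc n) (reflections cs z) w"
  proof (cases "z (Suc n) = w (Suc n)")
    case True
    with z w have "agree_upto (Suc n) z w"
      unfolding agree_upto_Suc by (auto simp: agree_upto_def)
    then show ?thesis by (intro exI[of _ "[]"]) simp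
  next
    case False
    \<comment> \<open>Up to time \<open>n\<close> the path \<open>z\<close> follows the pivot, which
      no longer moves after visiting \<open>a\<close>. All increments flipped before time
      \<open>n\<close> are therefore zero.\<close>
    have R: "agree_upto n (reflect a z) z"
      unfolding agree_upto_def
    proof (intro allI impI)
      fix j assume j: "j \<le> n"
      have "reflect a z j = (\<Sum>k<j. z (Suc k) - z k)"
        unfolding reflect_eq_resign resign_def
      proof (intro sum.cong refl)
        fix k assume "k \<in> {..<j}"
        then have k: "k < n" using j by simp
        then have "z i = a \<Longrightarrow> i \<le> k \<Longrightarrow> z (Suc k) = z k" for i
          using p(5)[of i k] z by (simp add: agree_upto_def)
        then show "reflect_sign a k z * (z (Suc k) - z k) = z (Suc k) - z k"
          by (auto simp: reflect_sign_def)
      qed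
      also have "\<dots> = z j" using lz by (simp add: sum_lessThan_telescope lattice_path_def)
      finally show "reflect a z j = z j" .
    qed
    \<comment> \<open>Since \<open>z n = a\<close>, the next increment is flipped, and this turns
      \<open>z (Suc n)\<close> into \<open>w (Suc n)\<close>.\<close>
    have "reflect_sign a n z = -1"
      using z p(4) by (auto simp: reflect_sign_def agree_upto_def)
    then have "reflect a z (Suc n) = reflect a z n - (z (Suc n) - z n)"
      using resign_increment[of "reflect_sign a" z n] by (simp add: reflect_eq_resign)
    also have "\<dots> = w (Suc n)"
      using R zw zw_abs False by (simp add: agree_upto_def abs_if split: if_splits)
    finally have "agree_upto (Suc n) (reflect a z) w"
      using R z w unfolding agree_upto_Suc by (auto simp: agree_upto_def)
    then show ?thesis using p(3) by (intro exI[of _ "[a]"]) simp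
  qed
  then obtain cs where cs: "set cs \<subseteq> {0, 1, 2}" "agree_upto (Suc n) (reflections cs z) w"
    by blast
  have "agree_upto (Suc n) (reflections (rev bs) (reflections cs z)) (reflections (rev bs) w)"
    by (rule agree_upto_reflections[OF cs(2)])
  also have "reflections (rev bs) w = y"
    unfolding w_def by (rule reflections_rev[OF Suc.prems(2)])
  finally have "agree_upto (Suc n) (reflections (rev bs @ cs @ as) x) y"
    by (simp add: z_def)
  then show ?case using as bs cs by (intro exI[of _ "rev bs @ cs @ as"]) auto
qed

subsection \<open>Laws on path space\<close>

lemma space_path_space [simp]: "space path_space = UNIV"
  by (simp add: space_PiM PiE_UNIV_domain)

text \<open>The prefix of a path lives in the countable type of integer lists.\<close>

lemma measurable_path_prefix:
  assumes "\<And>x y. agree_upto n x y \<Longrightarrow> h x = h y"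
  shows "h \<in> path_space \<rightarrow>\<^sub>M count_space UNIV"
proof -
  let ?pre = "\<lambda>x :: nat \<Rightarrow> int. map x [0..<Suc n]"
  have "?pre -` {l} \<in> sets path_space" for l
  proof -
    have "?pre -` {l} = {x \<in> space path_space. length l = Suc n \<and> (\<forall>k\<in>{..<Suc n}. x k = l ! k)}"
      by (auto simp: list_eq_iff_nth_eq simp del: upt_Suc)
    also have "\<dots> \<in> sets path_space" by measurable
    finally show ?thesis .
  qed
  then have pre: "?pre \<in> path_space \<rightarrow>\<^sub>M count_space UNIV"
    by (subst measurable_count_space_eq_countable) auto
  \<comment> \<open>The list extended by arbitrary values beyond index \<open>n\<close> agrees with
    \<open>x\<close> up to \<open>n\<close>, so \<open>h\<close> factors through the prefix.\<close>
  have "agree_upto n x (\<lambda>k. ?pre x ! k)" for x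
    by (simp add: agree_upto_def del: upt_Suc)
  then have "h = (\<lambda>l. h (\<lambda>k. l ! k)) \<circ> ?pre"
    using assms by (auto simp: fun_eq_iff)
  moreover have "(\<lambda>l. h (\<lambda>k. l ! k)) \<circ> ?pre \<in> path_space \<rightarrow>\<^sub>M count_space UNIV"
    by (rule measurable_comp[OF pre]) simp
  ultimately show ?thesis by simp
qed

lemma cylinder_sets [measurable]: "{y. agree_upto n y x} \<in> sets path_space"
proof -
  have "{y \<in> space path_space. agree_upto n y x} \<in> sets path_space"
    unfolding agree_upto_def by measurable
  then show ?thesis by simp
qed

text \<open>A coordinate event is a union of cylinders indexed by integer lists, of which there are
  countably many.\<close>

lemma sets_path_space:
  "sets path_space = sigma_sets UNIV (insert {} {{y. agree_upto n y x} |n x. True})" (is "_ = sigma_sets UNIV ?E")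
proof
  have "(\<lambda>x. x) \<in> sigma UNIV ?E \<rightarrow>\<^sub>M path_space"
  proof (rule measurable_PiM_single')
    fix i :: nat
    have "(\<lambda>x. x i) -` {c} \<in> sigma_sets UNIV ?E" for c
    proof -
      have "x \<in> (\<Union>l\<in>{l. l ! i = c}. {y. agree_upto i y (\<lambda>k. l ! k)})" if "x i = c" for x
        by (rule UN_I[of "map x [0..<Suc i]"])
          (use that in \<open>auto simp: agree_upto_def simp del: upt_Suc\<close>)
      then have "(\<lambda>x. x i) -` {c} = (\<Union>l\<in>{l. l ! i = c}. {y. agree_upto i y (\<lambda>k. l ! k)})"
        by (auto simp: agree_upto_def)
      also have "\<dots> \<in> sigma_sets UNIV ?E"
        by (rule sigma_sets_UNION) (auto intro!: sigma_sets.Basic countable_image)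
      finally show ?thesis .
    qed
    then show "(\<lambda>x. x i) \<in> sigma UNIV ?E \<rightarrow>\<^sub>M count_space UNIV"
      by (subst measurable_count_space_eq_countable) auto
  qed auto
  then show "sets path_space \<subseteq> sigma_sets UNIV ?E"
    by (auto dest: measurable_sets)
  have "sigma_sets (space path_space) ?E \<subseteq> sets path_space"
    using cylinder_sets by (intro sets.sigma_sets_subset) auto
  then show "sigma_sets UNIV ?E \<subseteq> sets path_space" by simp
qed

lemma path_measure_eqI:
  assumes "finite_measure \<mu>" "sets \<mu> = sets path_space" "sets \<nu> = sets path_space"
    and eq: "\<And>n x. emeasure \<mu> {y. agree_upto n y x} = emeasure \<nu> {y. agree_upto n y x}"
  shows "\<mu> = \<nu>"
proof -
  interpret finite_measure \<mu> by fact
  let ?E = "insert {} {{y. agree_upto n y x} |n x. True}"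
  \<comment> \<open>Two cylinders with a common path \<open>w\<close> meet in the longer cylinder
    around \<open>w\<close>. Otherwise they are disjoint, which is why the generator contains the
    empty set.\<close>
  have Int: "{y. agree_upto m y x} \<inter> {y. agree_upto n y z} \<in> ?E" for m n x z
  proof (cases "\<exists>w. agree_upto m w x \<and> agree_upto n w z")
    case True
    then obtain w where "agree_upto m w x" "agree_upto n w z" by blast
    then have "{y. agree_upto m y x} \<inter> {y. agree_upto n y z} = {y. agree_upto (max m n) y w}"
      by (auto simp: agree_upto_def le_max_iff_disj)
    then show ?thesis by blast
  qed auto
  show ?thesis
  proof (rule measure_eqI_generator_eq)
    show "Int_stable ?E"
    proof (rule Int_stableI)
      fix a b assume ab: "a \<in> ?E" "b \<in> ?E"
      show "a \<inter> b \<in> ?E"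
      proof (cases "a = {} \<or> b = {}")
        case False
        then obtain m x n z where "a = {y. agree_upto m y x}" "b = {y. agree_upto n y z}"
          using ab by blast
        then show ?thesis by (simp only: Int)
      qed auto
    qed
    show "sets \<mu> = sigma_sets UNIV ?E" "sets \<nu> = sigma_sets UNIV ?E"
      using assms sets_path_space by auto
    \<comment> \<open>Cylinders of level 0 fix only the initial value, so countably many of them
      cover the path space.\<close>
    show "range (\<lambda>i. {y. agree_upto 0 y (\<lambda>_. from_nat i)}) \<subseteq> ?E" by blast
    have "y \<in> {y. agree_upto 0 y (\<lambda>_. from_nat (to_nat (y 0)))}" for y :: "nat \<Rightarrow> int"
      by (simp add: agree_upto_def)
    then show "(\<Union>i. {y. agree_upto 0 y (\<lambda>_. from_nat i)}) = (UNIV :: (nat \<Rightarrow> int) set)" by blast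
    show "emeasure \<mu> {y. agree_upto 0 y (\<lambda>_. from_nat i)} \<noteq> \<infinity>" for i
      by simp
    show "emeasure \<mu> X = emeasure \<nu> X" if "X \<in> ?E" for X
      using that eq by (elim insertE) auto
  qed auto
qed

lemma sets_lattice_path: "{x. lattice_path x} \<in> sets path_space"
proof -
  have [measurable]: "Measurable.pred path_space (\<lambda>x. \<bar>x (Suc k) - x k\<bar> \<le> 1)" for k
    by (rule measurable_path_prefix[of "Suc k"]) (simp add: agree_upto_def)
  have [measurable]: "Measurable.pred path_space (\<lambda>x. x 0 = 0)"
    by (rule measurable_path_prefix[of 0]) (simp add: agree_upto_def)
  have "{x \<in> space path_space. x 0 = 0 \<and> (\<forall>k. \<bar>x (Suc k) - x k\<bar> \<le> 1)} \<in> sets path_space"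
    by measurable
  then show ?thesis by (simp add: lattice_path_def)
qed

lemma measurable_resign:
  assumes "sign_rule \<sigma>"
  shows "resign \<sigma> \<in> path_space \<rightarrow>\<^sub>M path_space"
proof -
  have "(\<lambda>x. resign \<sigma> x n) \<in> path_space \<rightarrow>\<^sub>M count_space UNIV" for n
    using agree_upto_resign[OF assms] by (intro measurable_path_prefix[of n]) (auto simp: agree_upto_def)
  then have "(\<lambda>x n. resign \<sigma> x n) \<in> path_space \<rightarrow>\<^sub>M path_space"
    by (intro measurable_PiM_single') auto
  then show ?thesis by simp
qed

lemma measurable_quadratic_variation [measurable]: "quadratic_variation \<in> path_space \<rightarrow>\<^sub>M path_space"
proof -
  have "(\<lambda>x. quadratic_variation x n) \<in> path_space \<rightarrow>\<^sub>M count_space UNIV" for n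
    by (intro measurable_path_prefix[of n]) (auto simp: agree_upto_def quadratic_variation_def)
  then have "(\<lambda>x n. quadratic_variation x n) \<in> path_space \<rightarrow>\<^sub>M path_space"
    by (intro measurable_PiM_single') auto
  then show ?thesis by simp
qed

subsection \<open>Invariance under predictable changes of sign\<close>

locale reflection_invariant = prob_space P for P :: "'a measure" +
  fixes M :: "nat \<Rightarrow> 'a \<Rightarrow> int"
  assumes skip_free: "skip_free P M"
    and reflection: "a \<in> {0, 1, 2} \<Longrightarrow> equal_in_law P (\<lambda>n \<omega>. reflect a (sample_path M \<omega>) n) M"
begin

definition path :: "'a \<Rightarrow> nat \<Rightarrow> int" where
  "path \<omega> n = M n \<omega>"

lemma measurable_path [measurable]: "path \<in> P \<rightarrow>\<^sub>M path_space"
proof -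
  have "(\<lambda>\<omega> n. M n \<omega>) \<in> P \<rightarrow>\<^sub>M path_space"
    using skip_free by (intro measurable_PiM_single') (auto simp: skip_free_def)
  then show ?thesis by (simp add: path_def[abs_def])
qed

lemma lattice_path_path:
  assumes "\<omega> \<in> space P"
  shows "lattice_path (path \<omega>)"
  unfolding lattice_path_def path_def
proof (intro conjI allI)
  show "M 0 \<omega> = 0" using assms skip_free by (simp add: skip_free_def)
  fix k
  have "M (Suc k) \<omega> - M (Suc k - 1) \<omega> \<in> {-1, 0, 1}"
    using assms skip_free unfolding skip_free_def by (metis One_nat_def Suc_leI zero_less_Suc)
  then show "\<bar>M (Suc k) \<omega> - M k \<omega>\<bar> \<le> 1" by auto
qed

lemma path_0: "\<omega> \<in> space P \<Longrightarrow> path \<omega> 0 = 0"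
  using lattice_path_path by (simp add: lattice_path_def)

section \<open>Probabilities of finite path prefixes\<close>

definition weight :: "nat \<Rightarrow> (nat \<Rightarrow> int) \<Rightarrow> real" where
  "weight n x = prob {\<omega> \<in> space P. agree_upto n (path \<omega>) x}"

lemma weight_resign:
  assumes "sign_rule \<sigma>" "x 0 = 0"
  shows "measure (distr P path_space (\<lambda>\<omega>. resign \<sigma> (path \<omega>))) {y. agree_upto n y x} = weight n (resign \<sigma> x)"
proof -
  have [measurable]: "(\<lambda>\<omega>. resign \<sigma> (path \<omega>)) \<in> P \<rightarrow>\<^sub>M path_space"
    using measurable_resign[OF assms(1)] by measurable
  show ?thesis
    unfolding weight_def using assms
    by (subst measure_distr)
      (auto intro!: arg_cong[where f = prob] simp: agree_upto_resign_iff path_0)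
qed

lemma measure_law_path: "measure (distr P path_space path) {y. agree_upto n y x} = weight n x"
  unfolding weight_def
  by (subst measure_distr) (auto intro!: arg_cong[where f = prob])

text \<open>This is the one place where the assumed invariance in law enters.\<close>

lemma weight_reflect:
  assumes "a \<in> {0, 1, 2}" "x 0 = 0"
  shows "weight n (reflect a x) = weight n x"
proof -
  have "distr P path_space (\<lambda>\<omega>. resign (reflect_sign a) (path \<omega>)) = distr P path_space path"
    using reflection[OF assms(1)]
    by (simp add: equal_in_law_def reflect_eq_resign path_def[abs_def])
  then show ?thesis
    using weight_resign[where x = x and n = n, OF sign_rule_reflect_sign[of a] assms(2)] measure_law_path[of n x]
    by (simp add: reflect_eq_resign)
qed

lemma weight_reflections:
  assumes "lattice_path x" "set as \<subseteq> {0, 1, 2}"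
  shows "weight n (reflections as x) = weight n x"
  using assms(2)
proof (induction as)
  case (Cons a as)
  have "reflections as x 0 = 0"
    using lattice_path_reflections[OF assms(1)] by (simp add: lattice_path_def)
  then show ?case using Cons weight_reflect[of a "reflections as x"] by simp
qed simp

lemma weight_cong: "agree_upto n x y \<Longrightarrow> weight n x = weight n y"
  unfolding weight_def by (intro arg_cong[where f = prob]) (auto simp: agree_upto_def)

text \<open>Some composition of the three reflections carries \<open>x\<close> to a path that agrees
  with \<open>y\<close> up to \<open>n\<close>, and each of them preserves the weight.\<close>

lemma weight_eq:
  assumes "lattice_path x" "lattice_path y"
    and "\<And>k. k < n \<Longrightarrow> \<bar>x (Suc k) - x k\<bar> = \<bar>y (Suc k) - y k\<bar>"
  shows "weight n x = weight n y"
  using reflections_transitive[OF assms] weight_reflections[OF assms(1)] weight_cong by metis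

lemma weight_eq_0: "(\<And>\<omega>. \<omega> \<in> space P \<Longrightarrow> \<not> agree_upto n (path \<omega>) x) \<Longrightarrow> weight n x = 0"
  unfolding weight_def by (metis (mono_tags, lifting) empty_Collect_eq measure_empty)

text \<open>On a cylinder around \<open>x\<close> the two laws give
  \<open>weight n (resign \<sigma> x)\<close> and \<open>weight n x\<close>, and a change of signs
  keeps the absolute increments.\<close>

lemma law_resign:
  assumes \<sigma>: "sign_rule \<sigma>"
  shows "distr P path_space (\<lambda>\<omega>. resign \<sigma> (path \<omega>)) = distr P path_space path"
proof (rule path_measure_eqI)
  have [measurable]: "(\<lambda>\<omega>. resign \<sigma> (path \<omega>)) \<in> P \<rightarrow>\<^sub>M path_space"
    using measurable_resign[OF \<sigma>] by measurable
  interpret L: prob_space "distr P path_space (\<lambda>\<omega>. resign \<sigma> (path \<omega>))"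
    by (rule prob_space_distr) measurable
  interpret L': prob_space "distr P path_space path"
    by (rule prob_space_distr) measurable
  show "finite_measure (distr P path_space (\<lambda>\<omega>. resign \<sigma> (path \<omega>)))"
    by (rule L.finite_measure_axioms)
  fix n x
  \<comment> \<open>\<open>weight_eq\<close> speaks of lattice paths, while \<open>x\<close> is an
    arbitrary integer sequence. A sample path with the same prefix takes its place.\<close>
  have visited: "weight n (resign \<sigma> z) = weight n z" if "\<omega> \<in> space P" "agree_upto n (path \<omega>) z" for \<omega> z
  proof -
    have "weight n (resign \<sigma> z) = weight n (resign \<sigma> (path \<omega>))"
      by (intro weight_cong agree_upto_resign \<sigma> agree_upto_sym[OF that(2)])
    also have "\<dots> = weight n (path \<omega>)"
      using that(1) \<sigma>
      by (intro weight_eq lattice_path_resign lattice_path_path abs_resign_increment)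
    also have "\<dots> = weight n z" by (rule weight_cong[OF that(2)])
    finally show ?thesis .
  qed
  have "measure (distr P path_space (\<lambda>\<omega>. resign \<sigma> (path \<omega>))) {y. agree_upto n y x} = weight n x"
  proof (cases "x 0 = 0")
    case x: True
    have "weight n (resign \<sigma> x) = weight n x"
    \<comment> \<open>If a sample path meets only the prefix of \<open>resign \<sigma> x\<close>,
      then \<open>visited\<close> is applied to that path and the involution leads back to
      \<open>x\<close>. If neither prefix is met, both weights are 0.\<close>
    proof (cases "\<exists>\<omega>\<in>space P. agree_upto n (path \<omega>) x \<or> agree_upto n (path \<omega>) (resign \<sigma> x)")
      case True
      then show ?thesis using visited resign_resign[where x = x, OF \<sigma> x] by metis
    next
      case False
      then show ?thesis using weight_eq_0[of n x] weight_eq_0[of n "resign \<sigma> x"] by metis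
    qed
    then show ?thesis using weight_resign[where x = x, OF \<sigma> x] by simp
  next
    case False
    then have "weight n x = 0"
      using path_0 by (intro weight_eq_0) (auto simp: agree_upto_def)
    moreover have "(\<lambda>\<omega>. resign \<sigma> (path \<omega>)) -` {y. agree_upto n y x} \<inter> space P = {}"
      using False by (auto simp: agree_upto_def)
    ultimately show ?thesis by (simp add: measure_distr)
  qed
  then show "emeasure (distr P path_space (\<lambda>\<omega>. resign \<sigma> (path \<omega>))) {y. agree_upto n y x}
      = emeasure (distr P path_space path) {y. agree_upto n y x}"
    unfolding L.emeasure_eq_measure L'.emeasure_eq_measure by (simp add: measure_law_path)
qed auto

end

subsection \<open>Fair coins\<close>

abbreviation coin :: "int pmf" where
  "coin \<equiv> pmf_of_set {-1, 1}"

abbreviation coins :: "(nat \<Rightarrow> int) measure" where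
  "coins \<equiv> PiM UNIV (\<lambda>_. measure_pmf coin)"

lemma sets_coins [measurable_cong, simp]: "sets coins = sets path_space"
  by (rule sets_PiM_cong) simp_all

lemma space_coins [simp]: "space coins = UNIV"
  by (simp add: space_PiM PiE_UNIV_domain)

lemma prob_space_coins: "prob_space coins"
  by (rule prob_space_PiM) (rule measure_pmf.prob_space_axioms)

lemma pmf_coin: "pmf coin c = (if c = 1 \<or> c = -1 then 1 / 2 else 0)"
  by (auto simp: pmf_of_set)

lemma emeasure_coins_cylinder:
  "emeasure coins {y. agree_upto n y x} = (\<Prod>i<Suc n. ennreal (pmf coin (x i)))"
proof -
  have "{y. agree_upto n y x} = prod_emb UNIV (\<lambda>_. measure_pmf coin) {..<Suc n} (Pi\<^sub>E {..<Suc n} (\<lambda>i. {x i}))"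
    unfolding agree_upto_def prod_emb_def space_measure_pmf
    by (simp add: set_eq_iff restrict_PiE_iff Pi_iff PiE_UNIV_domain less_Suc_eq_le Ball_def del: lessThan_Suc)
  moreover have "emeasure coins (prod_emb UNIV (\<lambda>_. measure_pmf coin) {..<Suc n} (Pi\<^sub>E {..<Suc n} (\<lambda>i. {x i})))
      = (\<Prod>i<Suc n. emeasure (measure_pmf coin) {x i})"
    by (rule emeasure_PiM_emb[where M = "\<lambda>_. measure_pmf coin" and A = "\<lambda>i. {x i}"])
      (simp_all add: measure_pmf.prob_space_axioms)
  ultimately show ?thesis by (simp only: emeasure_pmf_single)
qed

lemma distr_pair_snd:
  assumes "prob_space \<mu>" "prob_space \<nu>"
  shows "distr (\<mu> \<Otimes>\<^sub>M \<nu>) \<nu> snd = \<nu>"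
proof (rule measure_eqI)
  interpret \<mu>: prob_space \<mu> by fact
  interpret \<nu>: prob_space \<nu> by fact
  fix A assume "A \<in> sets (distr (\<mu> \<Otimes>\<^sub>M \<nu>) \<nu> snd)"
  then have A: "A \<in> sets \<nu>" by simp
  have "snd -` A \<inter> space (\<mu> \<Otimes>\<^sub>M \<nu>) = space \<mu> \<times> A"
    using sets.sets_into_space[OF A] by (auto simp: space_pair_measure)
  then show "emeasure (distr (\<mu> \<Otimes>\<^sub>M \<nu>) \<nu> snd) A = emeasure \<nu> A"
    using A by (simp add: emeasure_distr \<nu>.emeasure_pair_measure_Times \<mu>.emeasure_space_1)
qed simp

definition coin_flip :: "nat \<Rightarrow> (nat \<Rightarrow> int) \<Rightarrow> nat \<Rightarrow> int" where
  "coin_flip i \<xi> = \<xi>(i := - \<xi> i)"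

lemma coin_flip_apply: "coin_flip i \<xi> k = (if k = i then - \<xi> k else \<xi> k)"
  by (simp add: coin_flip_def)

lemma measurable_coin_flip: "coin_flip i \<in> path_space \<rightarrow>\<^sub>M path_space"
proof -
  have "(\<lambda>\<xi>. coin_flip i \<xi> k) \<in> path_space \<rightarrow>\<^sub>M count_space UNIV" for k
    by (intro measurable_path_prefix[of k]) (auto simp: agree_upto_def coin_flip_def)
  then have "(\<lambda>\<xi> k. coin_flip i \<xi> k) \<in> path_space \<rightarrow>\<^sub>M path_space"
    by (intro measurable_PiM_single') auto
  then show ?thesis by simp
qed

text \<open>A flip carries cylinders to cylinders, and \<open>coin\<close> gives \<open>c\<close>
  and \<open>-c\<close> the same mass.\<close>

lemma distr_coin_flip: "distr coins path_space (coin_flip i) = coins"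
proof (rule path_measure_eqI)
  have [measurable]: "coin_flip i \<in> coins \<rightarrow>\<^sub>M path_space"
    using measurable_coin_flip by (simp cong: measurable_cong_sets)
  show "finite_measure (distr coins path_space (coin_flip i))"
    by (rule prob_space.finite_measure[OF prob_space.prob_space_distr[OF prob_space_coins]]) measurable
  fix n x
  have "coin_flip i y k = x k \<longleftrightarrow> y k = coin_flip i x k" for y k
    by (auto simp: coin_flip_def)
  then have "coin_flip i -` {y. agree_upto n y x} = {y. agree_upto n y (coin_flip i x)}"
    by (simp add: agree_upto_def vimage_def)
  then have "emeasure (distr coins path_space (coin_flip i)) {y. agree_upto n y x}
      = (\<Prod>k<Suc n. ennreal (pmf coin (coin_flip i x k)))"
    by (simp add: emeasure_distr emeasure_coins_cylinder del: prod.lessThan_Suc)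
  also have "\<dots> = (\<Prod>k<Suc n. ennreal (pmf coin (x k)))"
    by (intro prod.cong refl) (auto simp: pmf_coin coin_flip_def)
  finally show "emeasure (distr coins path_space (coin_flip i)) {y. agree_upto n y x}
      = emeasure coins {y. agree_upto n y x}"
    by (simp only: emeasure_coins_cylinder)
qed simp_all

subsection \<open>The sequence of nonzero jumps\<close>

text \<open>On a lattice path the quadratic variation at time \<open>k\<close> is the number of
  earlier nonzero jumps, so jumps are numbered from 0.\<close>

definition is_jump :: "nat \<Rightarrow> (nat \<Rightarrow> int) \<Rightarrow> nat \<Rightarrow> bool" where
  "is_jump i x k \<longleftrightarrow> quadratic_variation x k = int i \<and> x (Suc k) \<noteq> x k"

text \<open>Only finitely many nonzero jumps may occur; the coins \<open>\<xi>\<close> supply the missing ones.\<close>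

definition jumps :: "(nat \<Rightarrow> int) \<times> (nat \<Rightarrow> int) \<Rightarrow> nat \<Rightarrow> int" where
  "jumps p i = (case p of (x, \<xi>) \<Rightarrow>
     if \<exists>k. is_jump i x k then x (Suc (THE k. is_jump i x k)) - x (THE k. is_jump i x k) else \<xi> i)"

text \<open>The quadratic variation increases strictly at a jump, so the level \<open>i\<close> is
  left for good.\<close>

lemma is_jump_unique:
  assumes "is_jump i x k" "is_jump i x l"
  shows "k = l"
proof -
  have "\<not> k < l" if "is_jump i x k" "is_jump i x l" for k l
  proof
    assume "k < l"
    then have "quadratic_variation x (Suc k) \<le> quadratic_variation x l"
      by (intro monoD[OF mono_quadratic_variation]) simp
    moreover have "0 < (x (Suc k) - x k)\<^sup>2" using that by (simp add: is_jump_def)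
    ultimately show False using that by (simp add: quadratic_variation_Suc is_jump_def)
  qed
  with assms show ?thesis by (metis linorder_neq_iff)
qed

lemma jumps_eq: "is_jump i x k \<Longrightarrow> jumps (x, \<xi>) i = x (Suc k) - x k"
  proof -
  assume k: "is_jump i x k"
  then have "(THE k. is_jump i x k) = k"
    by (rule the_equality) (rule is_jump_unique[OF _ k])
  with k show ?thesis by (auto simp: jumps_def)
qed

lemma jumps_eq_coin: "(\<And>k. \<not> is_jump i x k) \<Longrightarrow> jumps (x, \<xi>) i = \<xi> i"
  unfolding jumps_def by (auto split: if_splits)

text \<open>The pathwise time change: the walk with steps \<open>jumps\<close>, evaluated at the
  quadratic variation, is the path itself, whatever the coins are.\<close>

lemma sum_jumps:
  assumes x: "lattice_path x"
  shows "(\<Sum>i<nat (quadratic_variation x n). jumps (x, \<xi>) i) = x n"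
proof (induction n)
  case 0
  then show ?case using x by (simp add: lattice_path_def)
next
  case (Suc n)
  show ?case
  proof (cases "x (Suc n) = x n")
    case True
    then show ?thesis using Suc by (simp add: quadratic_variation_Suc)
  next
    case False
    have "\<bar>x (Suc n) - x n\<bar> \<le> 1" using x by (simp add: lattice_path_def)
    then have "\<bar>x (Suc n) - x n\<bar> = 1" using False by arith
    then have "nat (quadratic_variation x (Suc n)) = Suc (nat (quadratic_variation x n))"
      using quadratic_variation_nonneg[of x n] quadratic_variation_Suc_lattice[OF x, of n] by simp
    moreover have "is_jump (nat (quadratic_variation x n)) x n"
      using False quadratic_variation_nonneg[of x n] by (simp add: is_jump_def)
    ultimately show ?thesis using Suc by (simp add: jumps_eq)
  qed
qed

lemma measurable_is_jump: "Measurable.pred path_space (\<lambda>x. is_jump i x k \<and> R (x (Suc k) - x k))"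
  by (rule measurable_path_prefix[of "Suc k"])
    (auto simp: agree_upto_def is_jump_def quadratic_variation_def)

lemma measurable_jumps [measurable]: "jumps \<in> path_space \<Otimes>\<^sub>M path_space \<rightarrow>\<^sub>M path_space"
proof -
  have *: "Measurable.pred (path_space \<Otimes>\<^sub>M path_space) (\<lambda>p. is_jump i (fst p) k \<and> R (fst p (Suc k) - fst p k))"
    for i k R
    by (rule measurable_compose[OF measurable_fst measurable_is_jump])
  have [measurable]: "Measurable.pred (path_space \<Otimes>\<^sub>M path_space) (\<lambda>p. is_jump i (fst p) k)" for i k
    using *[of i k "\<lambda>_. True"] by simp
  have [measurable]: "Measurable.pred (path_space \<Otimes>\<^sub>M path_space) (\<lambda>p. is_jump i (fst p) k \<and> fst p (Suc k) - fst p k = c)" for i k c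
    by (rule *)
  have "(\<lambda>p. jumps p i) \<in> path_space \<Otimes>\<^sub>M path_space \<rightarrow>\<^sub>M count_space UNIV" for i
  proof (subst measurable_count_space_eq_countable, simp, intro conjI ballI)
    fix c
    \<comment> \<open>Uniqueness of the jump time replaces the definite description by countable
      quantifiers over measurable events.\<close>
    have "jumps p i = c \<longleftrightarrow> (\<exists>k. is_jump i (fst p) k \<and> fst p (Suc k) - fst p k = c)
           \<or> (\<forall>k. \<not> is_jump i (fst p) k) \<and> snd p i = c" for p
    proof (cases "\<exists>k. is_jump i (fst p) k")
      case True
      then obtain k where k: "is_jump i (fst p) k" by blast
      then have "is_jump i (fst p) l \<longleftrightarrow> l = k" for l using is_jump_unique[OF k] by blast
      then show ?thesis using jumps_eq[OF k, of "snd p"] by simp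
    next
      case False
      then show ?thesis using jumps_eq_coin[of i "fst p" "snd p"] by simp
    qed
    then have "(\<lambda>p. jumps p i) -` {c} \<inter> space (path_space \<Otimes>\<^sub>M path_space)
      = {p \<in> space (path_space \<Otimes>\<^sub>M path_space). (\<exists>k. is_jump i (fst p) k \<and> fst p (Suc k) - fst p k = c)
           \<or> (\<forall>k. \<not> is_jump i (fst p) k) \<and> snd p i = c}"
      by blast
    also have "\<dots> \<in> sets (path_space \<Otimes>\<^sub>M path_space)" by measurable
    finally show "(\<lambda>p. jumps p i) -` {c} \<inter> space (path_space \<Otimes>\<^sub>M path_space) \<in> sets (path_space \<Otimes>\<^sub>M path_space)" .
  qed auto
  then have "(\<lambda>p i. jumps p i) \<in> path_space \<Otimes>\<^sub>M path_space \<rightarrow>\<^sub>M path_space"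
    by (intro measurable_PiM_single') auto
  then show ?thesis by simp
qed

lemma measurable_jumps_nth [measurable]:
  "(\<lambda>p. jumps p i) \<in> path_space \<Otimes>\<^sub>M path_space \<rightarrow>\<^sub>M count_space UNIV"
  by (rule measurable_compose[OF measurable_jumps measurable_component_singleton]) simp

text \<open>The sign is -1 throughout the time spent at level \<open>i\<close>. All increments there
  except the one leaving the level are zero, so only the jump with index \<open>i\<close>
  changes.\<close>

definition jump_flip :: "nat \<Rightarrow> nat \<Rightarrow> (nat \<Rightarrow> int) \<Rightarrow> int" where
  "jump_flip i k x = (if quadratic_variation x k = int i then -1 else 1)"

lemma quadratic_variation_jump_flip:
  "quadratic_variation (resign (jump_flip i) x) = quadratic_variation x"
  by (rule quadratic_variation_resign) (simp add: jump_flip_def)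

text \<open>The sign is a function of the quadratic variation, which a change of signs
  preserves.\<close>

lemma sign_rule_jump_flip: "sign_rule (jump_flip i)"
proof -
  have "jump_flip i k x = jump_flip i k y" if "agree_upto k x y" for k x y
    using that by (simp add: jump_flip_def agree_upto_def quadratic_variation_def)
  moreover have "jump_flip i k (resign (jump_flip i) x) = jump_flip i k x" for k x
    by (simp add: jump_flip_def[of i k] quadratic_variation_jump_flip)
  moreover have "jump_flip i k x = 1 \<or> jump_flip i k x = -1" for k x
    by (simp add: jump_flip_def)
  ultimately show ?thesis unfolding sign_rule_def by blast
qed

text \<open>The jump times stay the same. If the jump with index \<open>i\<close> occurs,
  \<open>jump_flip\<close> reverses it; if not, \<open>coin_flip\<close> reverses the coin that
  stands in for it.\<close>

lemma jumps_flip: "jumps (resign (jump_flip i) x, coin_flip i \<xi>) = coin_flip i (jumps (x, \<xi>))"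
proof
  fix j
  have inc: "resign (jump_flip i) x (Suc k) - resign (jump_flip i) x k = jump_flip i k x * (x (Suc k) - x k)" for k
    by (rule resign_increment)
  have "resign (jump_flip i) x (Suc k) = resign (jump_flip i) x k \<longleftrightarrow> x (Suc k) = x k" for k
    using inc[of k] by (auto simp: jump_flip_def split: if_splits)
  then have iff: "is_jump j (resign (jump_flip i) x) k \<longleftrightarrow> is_jump j x k" for k
    by (simp add: is_jump_def quadratic_variation_jump_flip)
  show "jumps (resign (jump_flip i) x, coin_flip i \<xi>) j = coin_flip i (jumps (x, \<xi>)) j"
  proof (cases "\<exists>k. is_jump j x k")
    case True
    then obtain k where k: "is_jump j x k" by blast
    then have "jumps (resign (jump_flip i) x, coin_flip i \<xi>) j = jump_flip i k x * (x (Suc k) - x k)"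
      using jumps_eq[of j "resign (jump_flip i) x" k] iff inc by simp
    then show ?thesis using k jumps_eq[OF k, of \<xi>] by (auto simp: coin_flip_def jump_flip_def is_jump_def)
  next
    case False
    then show ?thesis using iff by (cases "j = i") (simp_all add: jumps_eq_coin coin_flip_def)
  qed
qed

context reflection_invariant
begin

subsection \<open>The martingale property\<close>

lemma measurable_M [measurable]: "M n \<in> P \<rightarrow>\<^sub>M count_space UNIV"
  using skip_free by (simp add: skip_free_def)

abbreviation \<F> :: "nat \<Rightarrow> 'a measure" where
  "\<F> \<equiv> natural_filtration P M"

lemma space_natural_filtration [simp]: "space (\<F> n) = space P"
  unfolding natural_filtration_def by (rule space_measure_of) auto

lemma sets_natural_filtration:
  "sets (\<F> n) = sigma_sets (space P) {M k -` B \<inter> space P |k B. k \<le> n}"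
  unfolding natural_filtration_def by (rule sets_measure_of) auto

lemma filtration_natural_filtration: "filtration (space P) \<F>"
proof
  fix i j :: nat assume "i \<le> j"
  then show "sets (\<F> i) \<le> sets (\<F> j)"
    unfolding sets_natural_filtration by (intro sigma_sets_mono') (auto dest: order_trans)
qed simp

lemma subalgebra_natural_filtration: "subalgebra P (\<F> n)"
  unfolding subalgebra_def sets_natural_filtration
  by (auto intro!: sets.sigma_sets_subset)

lemma measurable_natural_filtration: "(\<lambda>\<omega>. real_of_int (M n \<omega>)) \<in> borel_measurable (\<F> n)"
proof -
  have "M n \<in> \<F> n \<rightarrow>\<^sub>M count_space UNIV"
    by (rule measurableI) (auto simp: sets_natural_filtration intro!: sigma_sets.Basic)
  then show ?thesis by (rule measurable_compose) simp
qed

text \<open>Describes the events up to time \<open>n\<close> by path prefixes, so that changes of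
  sign after time \<open>n\<close> can be seen to preserve them.\<close>

lemma natural_filtration_prefix:
  assumes "A \<in> sets (\<F> n)"
  shows "\<exists>L. A = {\<omega> \<in> space P. path \<omega> \<in> L} \<and> (\<forall>x y. agree_upto n x y \<longrightarrow> x \<in> L \<longrightarrow> y \<in> L)"
  using assms unfolding sets_natural_filtration
proof (induction rule: sigma_sets.induct)
  case (Basic A)
  then obtain k B where kB: "A = M k -` B \<inter> space P" "k \<le> n" by blast
  then show ?case
    by (intro exI[of _ "{x. x k \<in> B}"]) (auto simp: path_def agree_upto_def)
next
  case Empty
  then show ?case by (intro exI[of _ "{}"]) auto
next
  case (Compl A)
  then obtain L where L: "A = {\<omega> \<in> space P. path \<omega> \<in> L}" "\<forall>x y. agree_upto n x y \<longrightarrow> x \<in> L \<longrightarrow> y \<in> L"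
    by blast
  have "space P - A = {\<omega> \<in> space P. path \<omega> \<in> - L}"
    using L(1) by auto
  moreover have "x \<in> - L \<Longrightarrow> y \<in> - L" if "agree_upto n x y" for x y
    using L(2) agree_upto_sym[OF that] by auto
  ultimately show ?case by blast
next
  case (Union A)
  then have "\<forall>i. \<exists>L. A i = {\<omega> \<in> space P. path \<omega> \<in> L} \<and> (\<forall>x y. agree_upto n x y \<longrightarrow> x \<in> L \<longrightarrow> y \<in> L)"
    by blast
  from choice[OF this] obtain L where L: "\<And>i. A i = {\<omega> \<in> space P. path \<omega> \<in> L i}"
      "\<And>i x y. agree_upto n x y \<Longrightarrow> x \<in> L i \<Longrightarrow> y \<in> L i"
    by blast
  have "(\<Union>i. A i) = {\<omega> \<in> space P. path \<omega> \<in> (\<Union>i. L i)}"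
    using L(1) by auto
  moreover have "x \<in> (\<Union>i. L i) \<Longrightarrow> y \<in> (\<Union>i. L i)" if "agree_upto n x y" for x y
    using L(2)[OF that] by auto
  ultimately show ?case by blast
qed

lemma integrable_M: "integrable P (\<lambda>\<omega>. real_of_int (M n \<omega>))"
proof (rule integrable_const_bound)
  show "AE \<omega> in P. norm (real_of_int (M n \<omega>)) \<le> real n"
  proof (rule AE_I2)
    fix \<omega> assume "\<omega> \<in> space P"
    then have "\<bar>M n \<omega>\<bar> \<le> int n" using lattice_path_abs[OF lattice_path_path] by (simp add: path_def)
    then show "norm (real_of_int (M n \<omega>)) \<le> real n" by simp
  qed
qed measurable

definition tail_sign :: "nat \<Rightarrow> nat \<Rightarrow> (nat \<Rightarrow> int) \<Rightarrow> int" where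
  "tail_sign m k x = (if m \<le> k then -1 else 1)"

lemma sign_rule_tail_sign: "sign_rule (tail_sign m)"
  by (simp add: sign_rule_def tail_sign_def)

lemma agree_upto_resign_tail_sign: "x 0 = 0 \<Longrightarrow> agree_upto m (resign (tail_sign m) x) x"
  unfolding agree_upto_def by (auto intro!: resign_eq_of_signs_one simp: tail_sign_def)

lemma resign_tail_sign_increment:
  assumes "m \<le> n"
  shows "resign (tail_sign m) x n - resign (tail_sign m) x m = - (x n - x m)"
  using assms
proof (induction n rule: dec_induct)
  case (step n)
  have "tail_sign m n x = -1" using step.hyps by (simp add: tail_sign_def)
  then show ?case using step.IH resign_increment[of "tail_sign m" x n] by simp
qed simp

text \<open>Flipping all increments after time \<open>m\<close> preserves the law of the path and
  the event \<open>A\<close>, but negates \<open>M n - M m\<close>. The integral of this difference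
  over \<open>A\<close> thus equals its own negative.\<close>

lemma set_integral_increment:
  assumes "m \<le> n" and A: "A \<in> sets (\<F> m)"
  shows "(\<integral>\<omega>\<in>A. real_of_int (M n \<omega>) \<partial>P) = (\<integral>\<omega>\<in>A. real_of_int (M m \<omega>) \<partial>P)"
proof -
  obtain L where L: "A = {\<omega> \<in> space P. path \<omega> \<in> L}"
    and L_imp: "\<And>x y. agree_upto m x y \<Longrightarrow> x \<in> L \<Longrightarrow> y \<in> L"
    using natural_filtration_prefix[OF A] by blast
  have L_iff: "x \<in> L \<longleftrightarrow> y \<in> L" if "agree_upto m x y" for x y
    using L_imp[OF that] L_imp[OF agree_upto_sym[OF that]] by blast
  define f where "f x = indicator L x * real_of_int (x n - x m)" for x :: "nat \<Rightarrow> int"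
  have "f \<in> path_space \<rightarrow>\<^sub>M count_space UNIV"
  proof (rule measurable_path_prefix[of n])
    fix x y assume xy: "agree_upto n x y"
    then have "x \<in> L \<longleftrightarrow> y \<in> L" using L_iff agree_upto_mono assms(1) by blast
    then show "f x = f y" using xy assms(1) by (simp add: f_def agree_upto_def indicator_def)
  qed
  then have f [measurable]: "f \<in> borel_measurable path_space"
    by (rule measurable_compose) simp
  let ?R = "resign (tail_sign m)"
  have [measurable]: "?R \<in> path_space \<rightarrow>\<^sub>M path_space"
    by (rule measurable_resign[OF sign_rule_tail_sign])
  have "(\<integral>\<omega>. f (path \<omega>) \<partial>P) = (\<integral>x. f x \<partial>distr P path_space (\<lambda>\<omega>. ?R (path \<omega>)))"
    unfolding law_resign[OF sign_rule_tail_sign] by (simp add: integral_distr)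
  also have "\<dots> = (\<integral>\<omega>. f (?R (path \<omega>)) \<partial>P)"
    by (simp add: integral_distr)
  also have "\<dots> = (\<integral>\<omega>. - f (path \<omega>) \<partial>P)"
  proof (rule Bochner_Integration.integral_cong[OF refl])
    fix \<omega> assume "\<omega> \<in> space P"
    then have "?R (path \<omega>) \<in> L \<longleftrightarrow> path \<omega> \<in> L"
      by (intro L_iff agree_upto_resign_tail_sign path_0)
    then show "f (?R (path \<omega>)) = - f (path \<omega>)"
      by (simp add: f_def indicator_def resign_tail_sign_increment[OF assms(1)] del: of_int_diff)
  qed
  finally have 0: "(\<integral>\<omega>. f (path \<omega>) \<partial>P) = 0" by simp
  have [measurable]: "A \<in> sets P" using A subalgebra_natural_filtration by (auto simp: subalgebra_def)
  have int: "integrable P (\<lambda>\<omega>. indicator A \<omega> * real_of_int (M k \<omega>))" for k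
    using integrable_mult_indicator[OF \<open>A \<in> sets P\<close> integrable_M] by simp
  have "(\<integral>\<omega>\<in>A. real_of_int (M n \<omega>) \<partial>P) - (\<integral>\<omega>\<in>A. real_of_int (M m \<omega>) \<partial>P)
      = (\<integral>\<omega>. indicator A \<omega> * real_of_int (M n \<omega>) - indicator A \<omega> * real_of_int (M m \<omega>) \<partial>P)"
    unfolding set_lebesgue_integral_def real_scaleR_def
    by (simp add: int)
  also have "\<dots> = (\<integral>\<omega>. f (path \<omega>) \<partial>P)"
    by (rule Bochner_Integration.integral_cong) (auto simp: f_def L path_def indicator_def)
  finally show ?thesis using 0 by simp
qed

lemma martingale_M: "martingale P \<F> (\<lambda>n \<omega>. real_of_int (M n \<omega>))"
proof -
  have "AE \<omega> in P. real_cond_exp P (\<F> m) (\<lambda>\<omega>. real_of_int (M n \<omega>)) \<omega> = real_of_int (M m \<omega>)"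
    if "m \<le> n" for m n
  proof -
    interpret finite_measure_subalgebra P "\<F> m"
      by unfold_locales (rule subalgebra_natural_filtration)
    show ?thesis
      by (intro real_cond_exp_charact set_integral_increment that integrable_M
          measurable_natural_filtration)
  qed
  then show ?thesis
    unfolding martingale_def
    by (simp add: filtration_natural_filtration subalgebra_natural_filtration
        measurable_natural_filtration integrable_M)
qed

lemma local_martingale_M: "natural_local_martingale P M"
proof -
  \<comment> \<open>A true martingale is localized by the stopping times that are constantly
    \<infinity>.\<close>
  have *: "stopped X (\<lambda>_. \<infinity>) = X" for X :: "nat \<Rightarrow> 'a \<Rightarrow> real"
    by (simp add: stopped_def fun_eq_iff)
  show ?thesis
    unfolding local_martingale_def
    by (intro conjI exI[of _ "\<lambda>_ _. \<infinity>"])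
      (simp_all add: * martingale_M filtration_natural_filtration subalgebra_natural_filtration
        measurable_natural_filtration extended_stopping_time_def mono_def)
qed

subsection \<open>Independence of the jumps and the quadratic variation\<close>

definition law :: "(nat \<Rightarrow> int) measure" where
  "law = distr P path_space path"

text \<open>The path of \<open>M\<close> together with the independent coins that
  \<open>jumps\<close> substitutes for missing jumps.\<close>

definition joint :: "((nat \<Rightarrow> int) \<times> (nat \<Rightarrow> int)) measure" where
  "joint = law \<Otimes>\<^sub>M coins"

lemma sets_law [measurable_cong, simp]: "sets law = sets path_space"
  by (simp add: law_def)

lemma prob_space_law: "prob_space law"
  unfolding law_def by (rule prob_space_distr) measurable

lemma sets_joint [measurable_cong, simp]: "sets joint = sets (path_space \<Otimes>\<^sub>M path_space)"
  unfolding joint_def by (rule sets_pair_measure_cong) simp_all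

lemma space_joint [simp]: "space joint = UNIV"
  by (simp add: joint_def law_def space_pair_measure)

lemma prob_space_joint: "prob_space joint"
  unfolding joint_def by (rule prob_space_pair[OF prob_space_law prob_space_coins])

lemma AE_law: "{x. R x} \<in> sets path_space \<Longrightarrow> (AE x in law. R x) \<longleftrightarrow> (AE \<omega> in P. R (path \<omega>))"
  unfolding law_def by (subst AE_distr_iff) simp_all

lemma distr_joint_fst: "distr joint law fst = law"
  unfolding joint_def by (rule prob_space.distr_pair_fst[OF prob_space_coins])

lemma distr_joint_snd: "distr joint coins snd = coins"
  unfolding joint_def by (rule distr_pair_snd[OF prob_space_law prob_space_coins])

lemma AE_joint_fst:
  assumes "AE x in law. R x"
  shows "AE p in joint. R (fst p)"
proof -
  have "AE x in distr joint law fst. R x"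
    unfolding distr_joint_fst by (rule assms)
  then show ?thesis
    by (rule AE_distrD[rotated]) (simp add: joint_def)
qed

lemma AE_joint_lattice_path: "AE p in joint. lattice_path (fst p)"
  using lattice_path_path by (intro AE_joint_fst) (auto simp: AE_law sets_lattice_path)

text \<open>Each entry is either a nonzero step of a lattice path or a fair coin.\<close>

lemma AE_joint_jumps: "AE p in joint. jumps p i = 1 \<or> jumps p i = -1"
proof -
  have "AE c in measure_pmf coin. c = 1 \<or> c = -1"
    by (auto simp: AE_measure_pmf_iff)
  then have "AE \<xi> in coins. \<xi> i = 1 \<or> \<xi> i = -1"
    by (intro AE_PiM_component) (auto intro: measure_pmf.prob_space_axioms)
  then have "AE \<xi> in distr joint coins snd. \<xi> i = 1 \<or> \<xi> i = -1"
    unfolding distr_joint_snd .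
  then have 2: "AE p in joint. snd p i = 1 \<or> snd p i = -1"
    by (rule AE_distrD[rotated]) (simp add: joint_def)
  from AE_joint_lattice_path 2 show ?thesis
  proof eventually_elim
    case (elim p)
    obtain x \<xi> where p: "p = (x, \<xi>)" by (cases p)
    show ?case
    proof (cases "\<exists>k. is_jump i x k")
      case True
      then obtain k where k: "is_jump i x k" by blast
      then have "x (Suc k) - x k \<noteq> 0" "\<bar>x (Suc k) - x k\<bar> \<le> 1"
        using elim(1) p k by (simp_all add: is_jump_def lattice_path_def)
      then have "x (Suc k) - x k = 1 \<or> x (Suc k) - x k = -1" by arith
      then show ?thesis using jumps_eq[OF k, of \<xi>] p by simp
    next
      case False
      then show ?thesis using elim(2) p by (simp add: jumps_eq_coin)
    qed
  qed
qed

lemma distr_joint_flip: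
  "distr joint (path_space \<Otimes>\<^sub>M path_space)
     (\<lambda>(x, \<xi>). (resign (jump_flip i) x, coin_flip i \<xi>)) = joint"
proof -
  have r: "resign (jump_flip i) \<in> path_space \<rightarrow>\<^sub>M path_space"
    by (rule measurable_resign[OF sign_rule_jump_flip])
  have "distr law path_space (resign (jump_flip i)) = law"
    unfolding law_def distr_distr[OF r measurable_path] comp_def
    by (rule law_resign[OF sign_rule_jump_flip])
  moreover have "distr law path_space (resign (jump_flip i)) \<Otimes>\<^sub>M distr coins path_space (coin_flip i)
      = distr joint (path_space \<Otimes>\<^sub>M path_space) (\<lambda>(x, \<xi>). (resign (jump_flip i) x, coin_flip i \<xi>))"
    unfolding joint_def
  proof (rule pair_measure_distr)
    show "resign (jump_flip i) \<in> law \<rightarrow>\<^sub>M path_space" using r by (simp cong: measurable_cong_sets)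
    show "coin_flip i \<in> coins \<rightarrow>\<^sub>M path_space"
      using measurable_coin_flip by (simp cong: measurable_cong_sets)
    show "sigma_finite_measure (distr coins path_space (coin_flip i))"
      unfolding distr_coin_flip
      using prob_space_coins by (rule prob_space_imp_sigma_finite)
  qed
  ultimately show ?thesis by (simp add: distr_coin_flip joint_def)
qed

text \<open>
  Flipping the \<open>k\<close>-th nonzero jump together with the \<open>k\<close>-th coin exchanges the two possible
  values of the \<open>k\<close>-th jump and fixes everything else, so both values have equal probability.
\<close>

lemma measure_joint_jumps:
  assumes B [measurable]: "B \<in> sets path_space"
  shows "measure joint {p. quadratic_variation (fst p) \<in> B \<and> (\<forall>i<k. jumps p i = e i)}
    = measure joint {p. quadratic_variation (fst p) \<in> B} * (\<Prod>i<k. pmf coin (e i))"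
proof (induction k)
  case 0
  then show ?case by simp
next
  case (Suc k)
  interpret joint: prob_space joint by (rule prob_space_joint)
  define E where "E = {p. quadratic_variation (fst p) \<in> B \<and> (\<forall>i<k. jumps p i = e i)}"
  define F where "F c = {p \<in> E. jumps p k = c}" for c
  have "{p \<in> space joint. quadratic_variation (fst p) \<in> B \<and> (\<forall>i\<in>{..<k}. jumps p i = e i)} \<in> sets joint"
    by measurable
  then have E [measurable]: "E \<in> sets joint" by (simp add: E_def Ball_def)
  have "{p \<in> space joint. p \<in> E \<and> jumps p k = c} \<in> sets joint" for c
    by measurable
  then have F: "F c \<in> sets joint" for c by (simp add: F_def)
  let ?G = "\<lambda>(x, \<xi>). (resign (jump_flip k) x, coin_flip k \<xi>)"
  have G: "?G \<in> joint \<rightarrow>\<^sub>M path_space \<Otimes>\<^sub>M path_space"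
  proof -
    have [measurable]: "resign (jump_flip k) \<in> path_space \<rightarrow>\<^sub>M path_space"
        "coin_flip k \<in> path_space \<rightarrow>\<^sub>M path_space"
      by (rule measurable_resign[OF sign_rule_jump_flip], rule measurable_coin_flip)
    show ?thesis by measurable
  qed
  have sym: "measure joint (F c) = measure joint (F (- c))" for c
  proof -
    have "measure joint (F c) = measure (distr joint (path_space \<Otimes>\<^sub>M path_space) ?G) (F c)"
      unfolding distr_joint_flip ..
    also have "\<dots> = measure joint (?G -` F c)"
      using F by (subst measure_distr[OF G]) auto
    \<comment> \<open>The flip leaves the quadratic variation and all jumps with index below
      \<open>k\<close> alone, and negates the one with index \<open>k\<close>.\<close>
    also have "?G -` F c = F (- c)"
      by (auto simp: F_def E_def jumps_flip quadratic_variation_jump_flip coin_flip_apply)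
    finally show ?thesis .
  qed
  \<comment> \<open>Up to a null set \<open>E\<close> splits into \<open>F 1\<close> and
    \<open>F (-1)\<close>, which have equal measure by \<open>sym\<close>.\<close>
  have "measure joint E = measure joint (F 1 \<union> F (-1))"
    using AE_joint_jumps[of k] E F by (intro joint.finite_measure_eq_AE) (auto simp: F_def)
  also have "\<dots> = measure joint (F 1) + measure joint (F (-1))"
    using F by (intro joint.finite_measure_Union) (auto simp: F_def)
  finally have half: "measure joint (F 1) = measure joint E / 2" "measure joint (F (-1)) = measure joint E / 2"
    using sym[of 1] by simp_all
  have "measure joint (F c) = measure joint E * pmf coin c" for c
  proof (cases "c = 1 \<or> c = -1")
    case True
    then show ?thesis using half by (auto simp: pmf_coin)
  next
    case False
    then have "measure joint (F c) = measure joint {}"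
      using AE_joint_jumps[of k] F by (intro joint.finite_measure_eq_AE) (auto simp: F_def)
    then show ?thesis using False by (simp add: pmf_coin)
  qed
  moreover have "{p. quadratic_variation (fst p) \<in> B \<and> (\<forall>i<Suc k. jumps p i = e i)} = F (e k)"
    by (auto simp: F_def E_def less_Suc_eq)
  ultimately show ?case using Suc by (simp add: E_def)
qed

text \<open>The clock is independent of the jumps, and the jumps are fair coins. For fixed
  \<open>B\<close> both sides are finite measures in \<open>C\<close>, so it suffices to compare
  them on cylinders, where \<open>measure_joint_jumps\<close> applies.\<close>

lemma distr_joint_jumps:
  "distr joint (path_space \<Otimes>\<^sub>M path_space) (\<lambda>p. (quadratic_variation (fst p), jumps p))
     = distr law path_space quadratic_variation \<Otimes>\<^sub>M coins" (is "?K = ?\<alpha> \<Otimes>\<^sub>M coins")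
proof (rule pair_measure_eqI[symmetric])
  interpret joint: prob_space joint by (rule prob_space_joint)
  interpret law: prob_space law by (rule prob_space_law)
  interpret coins: prob_space coins by (rule prob_space_coins)
  interpret \<alpha>: prob_space ?\<alpha> by (rule law.prob_space_distr) measurable
  show "sigma_finite_measure ?\<alpha>" "sigma_finite_measure coins" by unfold_locales
  show "sets (?\<alpha> \<Otimes>\<^sub>M coins) = sets ?K"
    by (simp cong: sets_pair_measure_cong)
  fix B C assume "B \<in> sets ?\<alpha>" and C: "C \<in> sets coins"
  then have B [measurable]: "B \<in> sets path_space" by simp
  define E :: "((nat \<Rightarrow> int) \<times> (nat \<Rightarrow> int)) set" where "E = {p. quadratic_variation (fst p) \<in> B}"
  have "{p \<in> space joint. quadratic_variation (fst p) \<in> B} \<in> sets joint" by measurable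
  then have E [measurable]: "E \<in> sets joint" by (simp add: E_def)
  have \<alpha>E: "emeasure ?\<alpha> B = emeasure joint E"
  proof -
    have "emeasure ?\<alpha> B = emeasure law (quadratic_variation -` B)"
      by (simp add: emeasure_distr law_def)
    also have "\<dots> = emeasure (distr joint law fst) (quadratic_variation -` B)"
      unfolding distr_joint_fst ..
    also have "\<dots> = emeasure joint E"
    proof (subst emeasure_distr)
      show "fst \<in> joint \<rightarrow>\<^sub>M law" by (simp add: joint_def)
      show "quadratic_variation -` B \<in> sets law"
        using measurable_sets[OF measurable_quadratic_variation B] by simp
    qed (auto simp: E_def intro!: arg_cong[where f = "emeasure joint"])
    finally show ?thesis .
  qed
  \<comment> \<open>The law of the jumps restricted to \<open>E\<close>, left unnormalized so that
    an event \<open>E\<close> of measure 0 needs no separate case.\<close>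
  let ?\<nu> = "distr (density joint (indicator E)) path_space jumps"
  have \<nu>: "emeasure ?\<nu> X = emeasure joint (E \<inter> jumps -` X)" if "X \<in> sets path_space" for X
  proof -
    have "jumps -` X \<in> sets joint"
      using measurable_sets[OF measurable_jumps that] by (simp add: space_pair_measure)
    from emeasure_restricted[OF E this] show ?thesis
      using that by (simp add: emeasure_distr)
  qed
  have "scale_measure (emeasure ?\<alpha> B) coins = ?\<nu>"
  proof (rule path_measure_eqI)
    show "finite_measure (scale_measure (emeasure ?\<alpha> B) coins)"
      by (rule finite_measureI) (simp add: ennreal_mult_eq_top_iff)
    fix n x
    have "E \<inter> jumps -` {y. agree_upto n y x} = {p. quadratic_variation (fst p) \<in> B \<and> (\<forall>i<Suc n. jumps p i = x i)}"
      by (auto simp: E_def agree_upto_def less_Suc_eq_le)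
    then have "emeasure ?\<nu> {y. agree_upto n y x}
        = emeasure joint {p. quadratic_variation (fst p) \<in> B \<and> (\<forall>i<Suc n. jumps p i = x i)}"
      by (simp only: \<nu>[OF cylinder_sets])
    also have "\<dots> = ennreal (measure joint E * (\<Prod>i<Suc n. pmf coin (x i)))"
      by (simp only: joint.emeasure_eq_measure measure_joint_jumps[OF B] E_def)
    also have "\<dots> = emeasure ?\<alpha> B * (\<Prod>i<Suc n. ennreal (pmf coin (x i)))"
      by (simp only: \<alpha>E joint.emeasure_eq_measure ennreal_mult measure_nonneg prod_nonneg pmf_nonneg prod_ennreal)
    finally show "emeasure (scale_measure (emeasure ?\<alpha> B) coins) {y. agree_upto n y x} = emeasure ?\<nu> {y. agree_upto n y x}"
      by (simp only: emeasure_scale_measure emeasure_coins_cylinder)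
  qed simp_all
  then have "emeasure ?\<alpha> B * emeasure coins C = emeasure ?\<nu> C"
    by (metis emeasure_scale_measure)
  also have "\<dots> = emeasure joint (E \<inter> jumps -` C)"
    using C by (intro \<nu>) simp
  also have "\<dots> = emeasure ?K (B \<times> C)"
    using C by (subst emeasure_distr) (auto simp: E_def intro!: arg_cong[where f = "emeasure joint"])
  finally show "emeasure ?\<alpha> B * emeasure coins C = emeasure ?K (B \<times> C)" .
qed

subsection \<open>The time-changed random walk\<close>

text \<open>Two copies of \<open>coins\<close> produce the type fixed in
  \<open>discrete_ocone\<close>; \<open>path_and_coins\<close> reads the first copy.\<close>

definition extension :: "('a \<times> (nat \<Rightarrow> int) \<times> (nat \<Rightarrow> int)) measure" where
  "extension = P \<Otimes>\<^sub>M coins \<Otimes>\<^sub>M coins"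

definition path_and_coins :: "'a \<times> (nat \<Rightarrow> int) \<times> (nat \<Rightarrow> int) \<Rightarrow> (nat \<Rightarrow> int) \<times> (nat \<Rightarrow> int)" where
  "path_and_coins \<omega> = (path (fst \<omega>), fst (snd \<omega>))"

lemma prob_space_extension: "prob_space extension"
  unfolding extension_def
  by (intro prob_space_pair prob_space_coins prob_space_axioms)

lemma measurable_path_and_coins [measurable]:
  "path_and_coins \<in> extension \<rightarrow>\<^sub>M path_space \<Otimes>\<^sub>M path_space"
  unfolding path_and_coins_def[abs_def] extension_def by measurable

lemma distr_extension_fst: "distr extension P fst = P"
  unfolding extension_def
  by (rule prob_space.distr_pair_fst[OF prob_space_pair[OF prob_space_coins prob_space_coins]])

lemma fst_extension: "\<omega> \<in> space extension \<Longrightarrow> fst \<omega> \<in> space P"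
  by (auto simp: extension_def space_pair_measure)

lemma distr_path_and_coins: "distr extension (path_space \<Otimes>\<^sub>M path_space) path_and_coins = joint"
proof -
  have fst: "distr (coins \<Otimes>\<^sub>M coins) coins fst = coins"
    by (rule prob_space.distr_pair_fst[OF prob_space_coins])
  have "distr P path_space path \<Otimes>\<^sub>M distr (coins \<Otimes>\<^sub>M coins) coins fst
      = distr extension (path_space \<Otimes>\<^sub>M coins) (\<lambda>(\<omega>, z). (path \<omega>, fst z))"
    unfolding extension_def
    by (rule pair_measure_distr)
      (simp_all add: fst prob_space_coins prob_space_imp_sigma_finite)
  also have "\<dots> = distr extension (path_space \<Otimes>\<^sub>M path_space) path_and_coins"
    by (rule distr_cong) (auto simp: path_and_coins_def cong: sets_pair_measure_cong)
  finally show ?thesis by (simp add: fst joint_def law_def)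
qed

definition walk :: "nat \<Rightarrow> 'a \<times> (nat \<Rightarrow> int) \<times> (nat \<Rightarrow> int) \<Rightarrow> int" where
  "walk n \<omega> = (\<Sum>i<n. jumps (path_and_coins \<omega>) i)"

definition clock :: "nat \<Rightarrow> 'a \<times> (nat \<Rightarrow> int) \<times> (nat \<Rightarrow> int) \<Rightarrow> int" where
  "clock n \<omega> = quadratic_variation (path (fst \<omega>)) n"

lemma M_eq_walk_clock:
  assumes "\<omega> \<in> space extension"
  shows "M n (fst \<omega>) = walk (nat (clock n \<omega>)) \<omega>"
  using sum_jumps[where n = n, OF lattice_path_path[OF fst_extension[OF assms]]]
  by (simp add: walk_def clock_def path_and_coins_def path_def)

lemma clock_path: "(\<lambda>n. clock n \<omega>) = quadratic_variation (fst (path_and_coins \<omega>))"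
  by (simp add: clock_def fun_eq_iff path_and_coins_def)

lemma measurable_clock: "(\<lambda>\<omega> n. clock n \<omega>) \<in> extension \<rightarrow>\<^sub>M path_space"
  unfolding clock_path by measurable

lemma measurable_jumps_path_and_coins: "(\<lambda>\<omega>. jumps (path_and_coins \<omega>)) \<in> extension \<rightarrow>\<^sub>M path_space"
  by measurable

lemma distr_clock_jumps:
  "distr extension (path_space \<Otimes>\<^sub>M path_space) (\<lambda>\<omega>. (\<lambda>n. clock n \<omega>, jumps (path_and_coins \<omega>)))
     = distr law path_space quadratic_variation \<Otimes>\<^sub>M coins"
proof -
  have "distr (distr extension (path_space \<Otimes>\<^sub>M path_space) path_and_coins) (path_space \<Otimes>\<^sub>M path_space)
      (\<lambda>p. (quadratic_variation (fst p), jumps p))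
    = distr extension (path_space \<Otimes>\<^sub>M path_space) (\<lambda>\<omega>. (\<lambda>n. clock n \<omega>, jumps (path_and_coins \<omega>)))"
    unfolding clock_path by (subst distr_distr) (auto simp: comp_def)
  then show ?thesis by (simp add: distr_path_and_coins distr_joint_jumps)
qed

lemma prob_space_law_clock: "prob_space (distr law path_space quadratic_variation)"
  by (rule prob_space.prob_space_distr[OF prob_space_law]) measurable

lemma distr_clock: "distr extension path_space (\<lambda>\<omega> n. clock n \<omega>) = distr law path_space quadratic_variation"
  (is "_ = ?\<alpha>")
proof -
  have "distr extension path_space (\<lambda>\<omega> n. clock n \<omega>) = distr (?\<alpha> \<Otimes>\<^sub>M coins) path_space fst"
    unfolding distr_clock_jumps[symmetric]
    using measurable_clock by (subst distr_distr) (auto simp: comp_def)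
  also have "\<dots> = distr (?\<alpha> \<Otimes>\<^sub>M coins) ?\<alpha> fst"
    by (rule distr_cong) simp_all
  also have "\<dots> = ?\<alpha>"
    by (rule prob_space.distr_pair_fst[OF prob_space_coins])
  finally show ?thesis .
qed

lemma distr_jumps: "distr extension path_space (\<lambda>\<omega>. jumps (path_and_coins \<omega>)) = coins"
proof -
  let ?\<alpha> = "distr law path_space quadratic_variation"
  have "distr extension path_space (\<lambda>\<omega>. jumps (path_and_coins \<omega>)) = distr (?\<alpha> \<Otimes>\<^sub>M coins) path_space snd"
    unfolding distr_clock_jumps[symmetric]
    using measurable_clock by (subst distr_distr) (auto simp: comp_def)
  also have "\<dots> = distr (?\<alpha> \<Otimes>\<^sub>M coins) coins snd"
    by (rule distr_cong) simp_all
  also have "\<dots> = coins"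
    by (rule distr_pair_snd[OF prob_space_law_clock prob_space_coins])
  finally show ?thesis .
qed

lemma distr_jump: "distr extension (count_space UNIV) (\<lambda>\<omega>. jumps (path_and_coins \<omega>) k) = measure_pmf coin"
proof -
  have "distr extension (count_space UNIV) (\<lambda>\<omega>. jumps (path_and_coins \<omega>) k)
      = distr (distr extension path_space (\<lambda>\<omega>. jumps (path_and_coins \<omega>))) (count_space UNIV) (\<lambda>y. y k)"
    by (subst distr_distr) (auto simp: comp_def)
  also have "\<dots> = distr coins (measure_pmf coin) (\<lambda>y. y k)"
    unfolding distr_jumps by (rule distr_cong) simp_all
  also have "\<dots> = measure_pmf coin"
    by (rule distr_PiM_component) (simp_all add: measure_pmf.prob_space_axioms)
  finally show ?thesis .
qed

lemma walk_increment: "walk (Suc k) \<omega> - walk k \<omega> = jumps (path_and_coins \<omega>) k"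
  by (simp add: walk_def)

lemma symmetric_bernoulli_walk_walk: "symmetric_bernoulli_walk extension walk"
proof -
  interpret Q: prob_space extension by (rule prob_space_extension)
  have "Q.indep_vars (\<lambda>_. count_space UNIV) (\<lambda>k \<omega>. jumps (path_and_coins \<omega>) k) UNIV"
    by (subst Q.indep_vars_iff_distr_eq_PiM) (simp_all add: distr_jump distr_jumps restrict_UNIV)
  then show ?thesis
    unfolding symmetric_bernoulli_walk_def walk_increment
    by (simp add: distr_jump walk_def)
qed

lemma increasing_skip_free_clock: "increasing_skip_free extension clock"
  unfolding increasing_skip_free_def skip_free_def
proof (intro conjI allI ballI impI)
  show "clock n \<in> extension \<rightarrow>\<^sub>M count_space UNIV" for n
    by (rule measurable_compose[OF measurable_clock measurable_component_singleton]) simp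
  fix \<omega> assume \<omega>: "\<omega> \<in> space extension"
  show "clock 0 \<omega> = 0" by (simp add: clock_def)
  show "mono (\<lambda>n. clock n \<omega>)" unfolding clock_def[abs_def] by (rule mono_quadratic_variation)
  fix n :: nat assume "1 \<le> n"
  then obtain k where n: "n = Suc k" by (cases n) auto
  have x: "lattice_path (path (fst \<omega>))" by (rule lattice_path_path[OF fst_extension[OF \<omega>]])
  then have "\<bar>path (fst \<omega>) (Suc k) - path (fst \<omega>) k\<bar> \<le> 1" by (simp add: lattice_path_def)
  then show "clock n \<omega> - clock (n - 1) \<omega> \<in> {-1, 0, 1}"
    using quadratic_variation_Suc_lattice[OF x, of k] by (auto simp: clock_def n)
qed

lemma indep_walk_clock:
  "prob_space.indep_var extension path_space (sample_path walk) path_space (sample_path clock)"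
proof -
  interpret Q: prob_space extension by (rule prob_space_extension)
  let ?sum = "\<lambda>(y :: nat \<Rightarrow> int) n. \<Sum>i<n. y i"
  let ?\<alpha> = "distr law path_space quadratic_variation"
  interpret coins: prob_space coins by (rule prob_space_coins)
  interpret \<alpha>: prob_space ?\<alpha> by (rule prob_space_law_clock)
  interpret coins_\<alpha>: pair_sigma_finite coins ?\<alpha> ..
  \<comment> \<open>\<open>distr_clock_jumps\<close> lists the clock first, whereas the claim lists
    the walk first, so the factors are swapped.\<close>
  have "coins \<Otimes>\<^sub>M ?\<alpha> = distr (?\<alpha> \<Otimes>\<^sub>M coins) (coins \<Otimes>\<^sub>M ?\<alpha>) (\<lambda>(x, y). (y, x))"
    by (rule coins_\<alpha>.distr_pair_swap)
  also have "\<dots> = distr (?\<alpha> \<Otimes>\<^sub>M coins) (path_space \<Otimes>\<^sub>M path_space) (\<lambda>(x, y). (y, x))"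
    by (rule distr_cong) (simp_all cong: sets_pair_measure_cong)
  also have "\<dots> = distr extension (path_space \<Otimes>\<^sub>M path_space)
      (\<lambda>\<omega>. (jumps (path_and_coins \<omega>), \<lambda>n. clock n \<omega>))"
    unfolding distr_clock_jumps[symmetric]
    using measurable_clock by (subst distr_distr) (auto simp: comp_def)
  finally have "Q.indep_var path_space (\<lambda>\<omega>. jumps (path_and_coins \<omega>)) path_space (\<lambda>\<omega> n. clock n \<omega>)"
    unfolding Q.indep_var_distribution_eq distr_clock distr_jumps
    using measurable_clock measurable_jumps_path_and_coins by simp
  \<comment> \<open>The walk is a measurable function of its steps, so it inherits their
    independence from the clock.\<close>
  moreover have "?sum \<in> path_space \<rightarrow>\<^sub>M path_space"
  proof (rule measurable_PiM_single')
    show "(\<lambda>y. \<Sum>i<n. y i) \<in> path_space \<rightarrow>\<^sub>M count_space UNIV" for n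
      by (rule measurable_path_prefix[of n]) (simp add: agree_upto_def)
  qed auto
  ultimately have "Q.indep_var path_space (?sum \<circ> (\<lambda>\<omega>. jumps (path_and_coins \<omega>)))
      path_space ((\<lambda>x. x) \<circ> (\<lambda>\<omega> n. clock n \<omega>))"
    by (rule Q.indep_var_compose) simp
  then show ?thesis by (simp add: comp_def walk_def[abs_def])
qed

lemma discrete_ocone_M: "discrete_ocone P M"
  unfolding discrete_ocone_def is_enlargement_def
proof (intro exI conjI allI ballI)
  show "fst \<in> extension \<rightarrow>\<^sub>M P" unfolding extension_def by measurable
qed (fact prob_space_extension distr_extension_fst symmetric_bernoulli_walk_walk
    increasing_skip_free_clock indep_walk_clock M_eq_walk_clock)+

subsection \<open>Divergence\<close>

lemma hitting_time_finite_iff: "hitting_time a x < \<infinity> \<longleftrightarrow> (\<exists>k. x k = a)"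
  unfolding hitting_time_def Inf_less_iff by auto

text \<open>
  If the path makes exactly \<open>m\<close> nonzero jumps with positive probability, then with positive
  probability all of them are \<open>-1\<close>, and the path never hits \<open>1\<close>.
\<close>

lemma AE_quadratic_variation_not_stationary:
  assumes hit: "AE \<omega> in P. \<exists>k. path \<omega> k = 1"
  shows "AE \<omega> in P. \<not> ((\<exists>n. quadratic_variation (path \<omega>) n = int m) \<and>
                       (\<forall>n. quadratic_variation (path \<omega>) n \<le> int m))"
proof -
  interpret joint: prob_space joint by (rule prob_space_joint)
  \<comment> \<open>The clocks that stop at exactly \<open>m\<close>.\<close>
  define B where "B = {y :: nat \<Rightarrow> int. (\<exists>n. y n = int m) \<and> (\<forall>n. y n \<le> int m)}"
  have le [measurable]: "Measurable.pred path_space (\<lambda>y. y n \<le> int m)" for n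
    by (rule measurable_path_prefix[of n]) (simp add: agree_upto_def)
  have "{y \<in> space path_space. (\<exists>n. y n = int m) \<and> (\<forall>n. y n \<le> int m)} \<in> sets path_space"
    by measurable
  then have B [measurable]: "B \<in> sets path_space" by (simp add: B_def)
  have "{x \<in> space path_space. \<exists>k. x k = 1} \<in> sets path_space" by measurable
  then have "AE x in law. \<exists>k. x k = 1" using hit by (subst AE_law) auto
  from AE_joint_fst[OF this] AE_joint_lattice_path
  have ae: "AE p in joint. \<not> (quadratic_variation (fst p) \<in> B \<and> (\<forall>i<m. jumps p i = -1))"
  proof eventually_elim
    case (elim p)
    obtain x \<xi> where p: "p = (x, \<xi>)" by (cases p)
    show ?case
    proof
      assume *: "quadratic_variation (fst p) \<in> B \<and> (\<forall>i<m. jumps p i = -1)"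
      obtain k where k: "x k = 1" using elim p by auto
      \<comment> \<open>At most \<open>m\<close> jumps have been made by time \<open>k\<close> and
        all of them are -1, so \<open>x k\<close> is at most 0.\<close>
      have "quadratic_variation x k \<le> int m" using * p by (auto simp: B_def)
      then have "nat (quadratic_variation x k) \<le> m" by simp
      then have "(\<Sum>i<nat (quadratic_variation x k). jumps (x, \<xi>) i) \<le> 0"
        using * p by (intro sum_nonpos) auto
      then show False using sum_jumps[of x \<xi> k] elim p k by simp
    qed
  qed
  have "{p \<in> space joint. quadratic_variation (fst p) \<in> B \<and> (\<forall>i\<in>{..<m}. jumps p i = -1)} \<in> sets joint"
    by measurable
  with ae have "measure joint {p. quadratic_variation (fst p) \<in> B \<and> (\<forall>i<m. jumps p i = -1)} = 0"
    using joint.prob_Collect_eq_0[of "\<lambda>p. quadratic_variation (fst p) \<in> B \<and> (\<forall>i<m. jumps p i = -1)"]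
    by (simp add: Ball_def)
  \<comment> \<open>The event has probability \<open>(1/2)^m\<close> times the probability that the
    clock lies in \<open>B\<close>, so the latter vanishes.\<close>
  then have 0: "measure joint {p. quadratic_variation (fst p) \<in> B} = 0"
    unfolding measure_joint_jumps[OF B, of m "\<lambda>_. -1"] by (simp add: pmf_coin)
  have Q: "{x. quadratic_variation x \<in> B} \<in> sets path_space"
    using measurable_sets[OF measurable_quadratic_variation B] by (simp add: vimage_def)
  have fst: "fst \<in> joint \<rightarrow>\<^sub>M law" by (simp add: joint_def)
  have "{p. quadratic_variation (fst p) \<in> B} \<in> sets joint"
    using measurable_sets[OF fst, of "{x. quadratic_variation x \<in> B}"] Q by (simp add: vimage_def)
  then have "AE p in joint. quadratic_variation (fst p) \<notin> B"
    using 0 joint.prob_Collect_eq_0[of "\<lambda>p. quadratic_variation (fst p) \<in> B"] by simp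
  then have "AE x in distr joint law fst. quadratic_variation x \<notin> B"
    using sets.compl_sets[OF Q]
    by (subst AE_distr_iff[OF fst])
      (simp_all add: Compl_eq_Diff_UNIV[symmetric] Collect_neg_eq law_def)
  then have "AE \<omega> in P. quadratic_variation (path \<omega>) \<notin> B"
    unfolding distr_joint_fst unfolding law_def by (rule AE_distrD[OF measurable_path])
  then show ?thesis by (simp add: B_def)
qed

lemma divergent_M:
  assumes "AE \<omega> in P. hitting_time 1 (sample_path M \<omega>) < \<infinity>"
  shows "divergent P M"
proof -
  have "AE \<omega> in P. \<exists>k. path \<omega> k = 1"
    using assms unfolding hitting_time_finite_iff path_def .
  then have "AE \<omega> in P. \<forall>m. \<not> ((\<exists>n. quadratic_variation (path \<omega>) n = int m) \<and>
                       (\<forall>n. quadratic_variation (path \<omega>) n \<le> int m))"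
    unfolding AE_all_countable by (intro allI AE_quadratic_variation_not_stationary)
  then show ?thesis
    unfolding divergent_def
  proof eventually_elim
    case (elim \<omega>)
    let ?q = "quadratic_variation (path \<omega>)"
    have unbounded: "\<exists>n. c \<le> ?q n" for c
    proof (rule ccontr)
      assume "\<not> (\<exists>n. c \<le> ?q n)"
      then have bound: "?q n \<le> c" for n by (meson linear)
      \<comment> \<open>A bounded integer-valued clock takes finitely many values and attains a
        maximum, which is one of the final values \<open>m\<close> excluded by
        \<open>elim\<close>.\<close>
      have "finite (range ?q)"
        by (rule finite_subset[of _ "{0..c}"]) (use bound quadratic_variation_nonneg in auto)
      then have max: "Max (range ?q) \<in> range ?q" "\<And>n. ?q n \<le> Max (range ?q)" by auto
      then obtain n where n: "?q n = Max (range ?q)" by (metis imageE)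
      then have "\<forall>k. ?q k \<le> int (nat (?q n))" "?q n = int (nat (?q n))"
        using max(2) quadratic_variation_nonneg[of "path \<omega>" n] by simp_all
      then show False using elim by blast
    qed
    have "filterlim ?q at_top sequentially"
      unfolding filterlim_at_top
    proof
      fix c
      obtain n where "c \<le> ?q n" using unbounded by blast
      then show "\<forall>\<^sub>F k in sequentially. c \<le> ?q k"
        unfolding eventually_sequentially
        by (meson mono_quadratic_variation monoD order_trans)
    qed
    then show ?case by (simp add: path_def[abs_def])
  qed
qed

end

theorem theorem3:
  fixes P :: "'a measure" and M :: "nat \<Rightarrow> 'a \<Rightarrow> int"
  assumes "prob_space P"
    and "skip_free P M"
    and "\<forall>a\<in>{0, 1, 2}. equal_in_law P (\<lambda>n \<omega>. reflect a (sample_path M \<omega>) n) M"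
  shows "(discrete_ocone P M \<and> natural_local_martingale P M) \<and>
         ((AE \<omega> in P. hitting_time 1 (sample_path M \<omega>) < \<infinity>) \<longrightarrow>
            divergent P M \<and> natural_local_martingale P M)"
proof -
  interpret prob_space P by fact
  interpret reflection_invariant P M
    by unfold_locales (use assms in auto)
  show ?thesis using discrete_ocone_M local_martingale_M divergent_M by blast
qed

end
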